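(* Let $\Omega=[0,1]^d$ be the $d$-dimensional torus and let $U_0,U_1\in C^\infty(\Omega,\mathbb{R})$ with $\int_\Omega e^{-U_0(x)}\,dx=1$. Put $\rho_0=e^{-U_0}$, $\mathcal{Z}_1=\int_\Omega e^{-U_1(x)}\,dx$ and $\rho_1=e^{-U_1}/\mathcal{Z}_1$. Let $\mathcal{D}:\Omega\to(0,\infty)$ be a smooth function with $\inf_{x\in\Omega}\mathcal{D}(x)>0$, and suppose that $V\in C^\infty(\Omega)$ solves the Poisson equation on $\Omega$ $$\nabla\cdot(\mathcal{D}\,\nabla V)=\rho_1-\rho_0,\qquad \int_\Omega V(x)\,dx=0 .$$ If $V$ is a Morse function, then $b=\nabla V$ is a zero-variance velocity field. That is, with the flow $X_t$, the Jacobian $J_t$ and the function $\mathcal{A}$ associated with $b=\nabla V$, $$\int_{\mathbb{R}}\rho_0(X_s(x))\,J_s(x)\,ds=\int_{\mathbb{R}}\rho_1(X_s(x))\,J_s(x)\,ds\qquad\text{for almost all } x\sim\rho_0,$$ and as a result $$\mathcal{A}(x)=\mathcal{Z}_1\qquad\text{for almost all } x\sim\rho_0 .$$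
   Context: For a smooth velocity field $b:\Omega\to\mathbb{R}^d$ on the torus, the flow map $X_t:\Omega\to\Omega$ ($t\in\mathbb{R}$) is defined by $\frac{d}{dt}X_t(x)=b(X_t(x))$, $X_0(x)=x$, and its Jacobian is $J_t(x)=|\det(\nabla_xX_t(x))|=\exp\big(\int_0^t(\nabla\cdot b)(X_s(x))\,ds\big)$. For $k\in\{0,1\}$ put $\mathcal{F}^{(k)}_t(x)=e^{-U_k(X_t(x))}J_t(x)$, and $$\mathcal{A}(x)=\frac{\int_{\mathbb{R}}\mathcal{F}^{(1)}_t(x)\,dt}{\int_{\mathbb{R}}\mathcal{F}^{(0)}_t(x)\,dt}.$$ A Morse function is a smooth function all of whose critical points have non-degenerate Hessian. *)

theory Defs
  imports "HOL-Analysis.Analysis"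
begin

text \<open>
  The $d$-dimensional torus is $R^d / Z^d$ with $d$ the cardinality of the index type. Functions
  on it are functions on $R^d$ with period 1 in every coordinate, and integrals over it
  are integrals over the fundamental cube $[0,1]^d$.
\<close>

abbreviation torus_cell :: "(real^'n) set" where
  "torus_cell \<equiv> cbox 0 1"

definition periodic :: "(real^'n \<Rightarrow> 'b) \<Rightarrow> bool" where
  "periodic f \<longleftrightarrow> (\<forall>x i. f (x + axis i 1) = f x)"

definition partial :: "'n \<Rightarrow> (real^'n \<Rightarrow> real) \<Rightarrow> real^'n \<Rightarrow> real" where
  "partial i f x = frechet_derivative f (at x) (axis i 1)"

primrec Ck :: "nat \<Rightarrow> (real^'n \<Rightarrow> real) \<Rightarrow> bool" where
  "Ck 0 f \<longleftrightarrow> continuous_on UNIV f"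
| "Ck (Suc k) f \<longleftrightarrow> (\<forall>x. f differentiable (at x)) \<and> (\<forall>i. Ck k (partial i f))"

definition smooth_torus :: "(real^'n \<Rightarrow> real) \<Rightarrow> bool" where
  "smooth_torus f \<longleftrightarrow> periodic f \<and> (\<forall>k. Ck k f)"

definition grad :: "(real^'n \<Rightarrow> real) \<Rightarrow> real^'n \<Rightarrow> real^'n" where
  "grad f x = (\<chi> i. partial i f x)"

definition divergence :: "(real^'n \<Rightarrow> real^'n) \<Rightarrow> real^'n \<Rightarrow> real" where
  "divergence b x = trace (jacobian b (at x))"

definition hessian :: "(real^'n \<Rightarrow> real) \<Rightarrow> real^'n \<Rightarrow> real^'n^'n" where
  "hessian f x = jacobian (grad f) (at x)"

definition morse :: "(real^'n \<Rightarrow> real) \<Rightarrow> bool" where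
  "morse f \<longleftrightarrow> smooth_torus f \<and> (\<forall>x. grad f x = 0 \<longrightarrow> invertible (hessian f x))"

text \<open>
  The flow of a periodic field is described by its lift to $R^d$: the trajectories are not
  reduced modulo $Z^d$. This affects neither its spatial derivative nor the value of a
  periodic function along it.
\<close>

definition is_flow :: "(real^'n \<Rightarrow> real^'n) \<Rightarrow> (real \<Rightarrow> real^'n \<Rightarrow> real^'n) \<Rightarrow> bool" where
  "is_flow b X \<longleftrightarrow>
     (\<forall>x. X 0 x = x \<and> (\<forall>t. ((\<lambda>s. X s x) has_vector_derivative b (X t x)) (at t)))"

definition flow_jac :: "(real \<Rightarrow> real^'n \<Rightarrow> real^'n) \<Rightarrow> real \<Rightarrow> real^'n \<Rightarrow> real" where
  "flow_jac X t x = \<bar>det (jacobian (X t) (at x))\<bar>"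

definition weight ::
    "(real^'n \<Rightarrow> real) \<Rightarrow> (real \<Rightarrow> real^'n \<Rightarrow> real^'n) \<Rightarrow> real \<Rightarrow> real^'n \<Rightarrow> real" where
  "weight U X t x = exp (- U (X t x)) * flow_jac X t x"

definition estimator ::
    "(real^'n \<Rightarrow> real) \<Rightarrow> (real^'n \<Rightarrow> real) \<Rightarrow> (real \<Rightarrow> real^'n \<Rightarrow> real^'n) \<Rightarrow> real^'n \<Rightarrow> real" where
  "estimator U0 U1 X x = (LINT t|lborel. weight U1 X t x) / (LINT t|lborel. weight U0 X t x)"

definition torus_measure :: "(real^'n \<Rightarrow> real) \<Rightarrow> (real^'n) measure" where
  "torus_measure \<rho> = density (restrict_space lborel torus_cell) (\<lambda>x. ennreal (\<rho> x))"

end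

theory Submission
  imports Defs
begin

text \<open>
  Write $b = \nabla V$ and $J_t(x)$ for the Jacobian of the flow. Liouville's formula
  $\frac{d}{dt} J_t(x) = J_t(x) \, (\nabla \cdot b)(X_t(x))$ combined with the Poisson equation gives
  \[ \frac{d}{dt} \big( J_t(x) \, D(X_t(x)) \big)
     = J_t(x) \, \nabla \cdot (D \nabla V)(X_t(x)) = J_t(x) \, (\rho_1 - \rho_0)(X_t(x)) . \]
  If $t \mapsto J_t(x)$ is integrable over the whole line, then both sides are integrable, because $D$,
  $\rho_0$ and $\rho_1$ are bounded. The derivative of an integrable function has
  integral $0$ as soon as it is itself integrable (lemma \<open>integral_derivative_eq_0\<close>), so the weighted
  integrals of $\rho_0$ and $\rho_1$ along the orbit agree (lemma \<open>gradient_flow_balance\<close>).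
  The value of the estimator is their quotient multiplied by $Z_1$.

  It remains to see that $J_t(x)$ is integrable in time for almost every $x$
  (lemma \<open>gradient_flow_jac_integrable\<close>). The textbook route would be that almost every orbit runs from a
  non-degenerate minimum to a non-degenerate maximum, near which the Jacobian decays exponentially; it
  needs the stable manifold theorem. Here a mass transport argument replaces it. The flow is a
  bijection of the torus, so the change of variables $y = X_t(x)$, followed by Tonelli, yields
  \[ \int_\Omega |\nabla V(x)|^2 \int_R J_t(x) \, dt \, dx
     = \int_\Omega \int_R |\nabla V(X_{-t}(y))|^2 \, dt \, dy , \]
  and the inner integral on the right is the total variation of $V$ along an orbit, since
  $\frac{d}{dt} V(X_t) = |\nabla V(X_t)|^2$; it is at most $2 \sup |V|$. Hence
  $\int_R J_t(x) \, dt$ is finite for almost every $x$ with $\nabla V(x) \ne 0$.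
  The Morse condition makes the critical points isolated, hence a null set
  (lemma \<open>morse_critical_points_null\<close>).

  The change of variables needs the derivative of the flow in its initial point. It is obtained directly from
  the quadratic Taylor bound of the field: by Gronwall's inequality the increments of the flow respect linear relations
  up to a quadratic error, so the difference quotients converge (lemmas \<open>flow_almost_linear\<close> and
  \<open>almost_linear_limit\<close>). The flow is lifted to $R^n$, and the formula on the torus follows from the one on
  $R^n$ by summation over lattice translates (lemma \<open>nn_integral_torus_change_of_variables\<close>).
\<close>

section \<open>Change of variables for finite index types\<close>

text \<open>
  The theorem \<open>has_measure_differentiable_image\<close> speaks of index types with a well-order. Every finite
  type has a copy that carries one, and neither volumes nor determinants depend on the order of the
  coordinates, so the change of variables formula transfers to all finite index types.
\<close>

typedef 'a ordered_copy = "UNIV :: 'a set" by simp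

instance ordered_copy :: (finite) finite
proof
  have "finite (Abs_ordered_copy ` (UNIV :: 'a set))" by simp
  also have "Abs_ordered_copy ` (UNIV :: 'a set) = UNIV"
    by (metis type_definition.Abs_image type_definition_ordered_copy)
  finally show "finite (UNIV :: 'a ordered_copy set)" .
qed

instantiation ordered_copy :: (countable) wellorder
begin

definition less_eq_ordered_copy :: "'a ordered_copy \<Rightarrow> 'a ordered_copy \<Rightarrow> bool" where
  "x \<le> y \<longleftrightarrow> to_nat (Rep_ordered_copy x) \<le> to_nat (Rep_ordered_copy y)"

definition less_ordered_copy :: "'a ordered_copy \<Rightarrow> 'a ordered_copy \<Rightarrow> bool" where
  "x < y \<longleftrightarrow> to_nat (Rep_ordered_copy x) < to_nat (Rep_ordered_copy y)"

instance
proof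
  fix P :: "'a ordered_copy \<Rightarrow> bool" and a
  assume *: "\<And>x. (\<And>y. y < x \<Longrightarrow> P y) \<Longrightarrow> P x"
  show "P a"
    by (induction "to_nat (Rep_ordered_copy a)" arbitrary: a rule: less_induct)
       (metis * less_ordered_copy_def)
qed (auto simp: less_eq_ordered_copy_def less_ordered_copy_def Rep_ordered_copy_inject)

end

lemma bij_Rep_ordered_copy: "bij Rep_ordered_copy"
  by (rule o_bij[where g = Abs_ordered_copy])
     (simp_all add: fun_eq_iff Rep_ordered_copy_inverse Abs_ordered_copy_inverse)

text \<open>
  Conjugation with the bijection turns the permutations of one index type into those of the
  other and preserves the sign.
\<close>

lemma det_reindex:
  fixes M :: "'a::comm_ring_1^'n^'n" and r :: "'m::finite \<Rightarrow> 'n::finite"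
  assumes r: "bij r"
  shows "det (\<chi> i j. M $ r i $ r j :: 'a^'m^'m) = det M"
proof -
  have inv: "inv_into UNIV r (r x) = x" "r (inv_into UNIV r y) = y" for x y
    using r by (simp_all add: bij_is_inj bij_is_surj surj_f_inv_f)
  define F where "F p = (\<lambda>x. r (p (inv_into UNIV r x)))" for p
  define G where "G q = (\<lambda>x. inv_into UNIV r (q (r x)))" for q
  have bF: "bij_betw F {p. p permutes UNIV} {p. p permutes UNIV}"
  proof (rule bij_betw_byWitness[where f' = G])
    have "bij (F p)" if "bij p" for p
    proof -
      have "F p = r \<circ> p \<circ> inv_into UNIV r"
        by (simp add: F_def fun_eq_iff)
      then show ?thesis using r that by (auto intro!: bij_comp bij_imp_bij_inv)
    qed
    then show "F ` {p. p permutes UNIV} \<subseteq> {p. p permutes UNIV}"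
      by (auto intro!: bij_imp_permutes dest: permutes_bij)
    have "bij (G p)" if "bij p" for p
    proof -
      have "G p = inv_into UNIV r \<circ> p \<circ> r"
        by (simp add: G_def fun_eq_iff)
      then show ?thesis using r that by (auto intro!: bij_comp bij_imp_bij_inv)
    qed
    then show "G ` {p. p permutes UNIV} \<subseteq> {p. p permutes UNIV}"
      by (auto intro!: bij_imp_permutes dest: permutes_bij)
  qed (auto simp: F_def G_def inv)
  have sgn: "sign (F p) = sign p" if "p permutes UNIV" for p
  proof -
    have "map_permutation UNIV r p = F p"
      unfolding map_permutation_def F_def by (auto simp: restrict_id_def fun_eq_iff r bij_is_surj)
    then show ?thesis
      using sign_map_permutation[of r UNIV p] that r by (auto simp: bij_is_inj)
  qed
  have "det M = (\<Sum>p | p permutes (UNIV::'n set). of_int (sign p) * (\<Prod>i\<in>UNIV. M $ i $ p i))"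
    by (simp add: det_def)
  also have "\<dots> = (\<Sum>p | p permutes (UNIV::'m set). of_int (sign (F p)) * (\<Prod>i\<in>UNIV. M $ i $ F p i))"
    using sum.reindex_bij_betw[OF bF, symmetric] by fastforce
  also have "\<dots> = (\<Sum>p | p permutes (UNIV::'m set). of_int (sign p) * (\<Prod>i\<in>UNIV. M $ r i $ r (p i)))"
  proof (rule sum.cong[OF refl])
    fix p :: "'m \<Rightarrow> 'm" assume "p \<in> {p. p permutes UNIV}"
    moreover have "(\<Prod>i\<in>UNIV. M $ i $ F p i) = (\<Prod>i\<in>UNIV. M $ r i $ F p (r i))"
      using prod.reindex_bij_betw[OF r, of "\<lambda>i. M $ i $ F p i"] by simp
    ultimately show "of_int (sign (F p)) * (\<Prod>i\<in>UNIV. M $ i $ F p i)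
        = of_int (sign p) * (\<Prod>i\<in>UNIV. M $ r i $ r (p i))"
      using sgn[of p] by (simp add: F_def inv)
  qed
  finally show ?thesis by (simp add: det_def)
qed

lemma lborel_reindex:
  fixes r :: "'n::finite \<Rightarrow> 'm::finite"
  assumes r: "bij r"
  shows "distr lborel borel (\<lambda>x::real^'m. \<chi> i. x $ r i) = (lborel :: (real^'n) measure)"
proof (rule lborel_eqI[symmetric])
  let ?\<psi> = "\<lambda>x::real^'m. (\<chi> i. x $ r i) :: real^'n"
  have [measurable]: "?\<psi> \<in> borel_measurable borel"
    by (intro borel_measurable_continuous_onI continuous_intros)
  have inv: "inv_into UNIV r (r x) = x" "r (inv_into UNIV r y) = y" for x y
    using r by (simp_all add: bij_is_inj bij_is_surj surj_f_inv_f)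
  fix l u :: "real^'n"
  assume "\<And>b. b \<in> Basis \<Longrightarrow> l \<bullet> b \<le> u \<bullet> b"
  then have le: "l $ i \<le> u $ i" for i
    by (metis axis_in_Basis_iff cart_eq_inner_axis Basis_real_def insertI1)
  let ?l = "(\<chi> j. l $ inv_into UNIV r j) :: real^'m" and ?u = "(\<chi> j. u $ inv_into UNIV r j) :: real^'m"
  have "?\<psi> -` box l u = box ?l ?u"
    unfolding set_eq_iff vimage_eq mem_box_cart vec_lambda_beta by (metis inv)
  then have "emeasure (distr lborel borel ?\<psi>) (box l u) = emeasure lborel (box ?l ?u)"
    by (simp add: emeasure_distr)
  also have "\<dots> = (\<Prod>b\<in>Basis. (?u - ?l) \<bullet> b)"
    by (intro emeasure_lborel_box) (auto simp: Basis_vec_def inner_axis le)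
  also have "(\<Prod>b\<in>Basis. (?u - ?l) \<bullet> b) = (\<Prod>j\<in>UNIV. ?u $ j - ?l $ j)"
    by (simp add: Basis_vec_def UNION_singleton_eq_range prod.reindex inner_axis inj_on_def axis_eq_axis)
  also have "\<dots> = (\<Prod>i\<in>UNIV. u $ i - l $ i)"
    using prod.reindex_bij_betw[OF r, of "\<lambda>j. ?u $ j - ?l $ j"] by (simp add: inv)
  also have "\<dots> = (\<Prod>b\<in>Basis. (u - l) \<bullet> b)"
    by (simp add: Basis_vec_def UNION_singleton_eq_range prod.reindex inner_axis inj_on_def axis_eq_axis)
  finally show "emeasure (distr lborel borel ?\<psi>) (box l u) = (\<Prod>b\<in>Basis. (u - l) \<bullet> b)" .
qed simp

text \<open>
  Boxes generate the Borel sets, so it suffices to compare the volume of a box with the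
  integral of the Jacobian over its preimage.
\<close>

lemma nn_integral_change_of_variables_wellorder:
  fixes g :: "real^'m::{finite,wellorder} \<Rightarrow> real^'m::_"
  assumes g: "bij g" and der: "\<And>x. (g has_derivative g' x) (at x)"
    and meas: "(\<lambda>x. det (matrix (g' x))) \<in> borel_measurable borel"
    and f: "f \<in> borel_measurable borel"
  shows "(\<integral>\<^sup>+ y. f y \<partial>lborel) = (\<integral>\<^sup>+ x. f (g x) * ennreal \<bar>det (matrix (g' x))\<bar> \<partial>lborel)"
proof -
  note [measurable] = meas f
  have cg: "continuous_on UNIV g"
    using der has_derivative_continuous by (metis continuous_at_imp_continuous_on)
  then have [measurable]: "g \<in> borel_measurable borel"
    by (rule borel_measurable_continuous_onI)
  let ?J = "\<lambda>x. \<bar>det (matrix (g' x))\<bar>"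
  have "distr (density lborel (\<lambda>x. ennreal (?J x))) borel g = lborel"
  proof (rule lborel_eqI[symmetric])
    fix l u :: "real^'m::_"
    assume le: "\<And>b. b \<in> Basis \<Longrightarrow> l \<bullet> b \<le> u \<bullet> b"
    let ?S = "g -` box l u"
    have S: "?S \<in> sets borel"
      using measurable_sets[of g borel borel "box l u"] by simp
    have im: "g ` ?S = box l u"
      using g by (simp add: bij_is_surj surj_image_vimage_eq)
    have "(?J has_integral measure lebesgue (box l u)) ?S"
      using has_measure_differentiable_image[of ?S g g' "measure lebesgue (box l u)"] S der g im
      by (auto simp: has_derivative_at_withinI inj_on_subset[OF bij_is_inj])
    then have "(\<integral>\<^sup>+ x. indicator ?S x * ?J x \<partial>lborel) = ennreal (measure lebesgue (box l u))"
      by (rule nn_integral_has_integral_lebesgue[rotated]) simp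
    then have "emeasure (distr (density lborel (\<lambda>x. ennreal (?J x))) borel g) (box l u)
        = ennreal (measure lebesgue (box l u))"
      using S by (simp add: emeasure_distr emeasure_density ennreal_mult' ennreal_indicator mult.commute)
    also have "\<dots> = (\<Prod>b\<in>Basis. (u - l) \<bullet> b)"
      using le by (simp add: measure_lborel_box_eq)
    finally show "emeasure (distr (density lborel (\<lambda>x. ennreal (?J x))) borel g) (box l u)
        = (\<Prod>b\<in>Basis. (u - l) \<bullet> b)" .
  qed simp
  then have "(\<integral>\<^sup>+ y. f y \<partial>lborel) = (\<integral>\<^sup>+ y. f y \<partial>distr (density lborel (\<lambda>x. ennreal (?J x))) borel g)"
    by simp
  also have "\<dots> = (\<integral>\<^sup>+ x. ennreal (?J x) * f (g x) \<partial>lborel)"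
    by (simp add: nn_integral_distr nn_integral_density)
  finally show ?thesis by (simp add: mult.commute)
qed

lemma nn_integral_change_of_variables:
  fixes g :: "real^'n \<Rightarrow> real^'n"
  assumes g: "bij g" and der: "\<And>x. (g has_derivative g' x) (at x)"
    and meas: "(\<lambda>x. det (matrix (g' x))) \<in> borel_measurable borel"
    and f: "f \<in> borel_measurable borel"
  shows "(\<integral>\<^sup>+ y. f y \<partial>lborel) = (\<integral>\<^sup>+ x. f (g x) * ennreal \<bar>det (matrix (g' x))\<bar> \<partial>lborel)"
proof -
  note [measurable] = meas f
  have cg: "continuous_on UNIV g"
    using der has_derivative_continuous by (metis continuous_at_imp_continuous_on)
  then have [measurable]: "g \<in> borel_measurable borel"
    by (rule borel_measurable_continuous_onI)
  let ?r = "Rep_ordered_copy :: 'n ordered_copy \<Rightarrow> 'n"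
  let ?s = "Abs_ordered_copy :: 'n \<Rightarrow> 'n ordered_copy"
  have rs: "?r (?s i) = i" "?s (?r j) = j" for i j
    by (simp_all add: Rep_ordered_copy_inverse Abs_ordered_copy_inverse)
  have bs: "bij ?s" by (rule o_bij[where g = ?r]) (simp_all add: fun_eq_iff rs)
  let ?\<psi> = "\<lambda>x::real^'n ordered_copy. (\<chi> i. x $ ?s i) :: real^'n"
  let ?\<phi> = "\<lambda>x::real^'n. (\<chi> i. x $ ?r i) :: real^'n ordered_copy"
  have lin: "linear ?\<psi>" "linear ?\<phi>"
    by (auto intro!: linearI simp: vec_eq_iff)
  have [measurable]: "?\<psi> \<in> borel_measurable borel" "?\<phi> \<in> borel_measurable borel"
    by (intro borel_measurable_continuous_onI continuous_intros)+
  have lb: "(\<integral>\<^sup>+ y. h y \<partial>lborel) = (\<integral>\<^sup>+ x. h (?\<psi> x) \<partial>lborel)"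
    if [measurable]: "h \<in> borel_measurable borel" for h :: "real^'n \<Rightarrow> ennreal"
    using nn_integral_distr[of ?\<psi> lborel borel h] by (simp add: lborel_reindex[OF bs])
  define G where "G = (\<lambda>x. ?\<phi> (g (?\<psi> x)))"
  define G' where "G' = (\<lambda>x h. ?\<phi> (g' (?\<psi> x) (?\<psi> h)))"
  have bG: "bij G"
  proof -
    have "bij ?\<psi>"
      by (rule o_bij[where g = ?\<phi>]) (simp_all add: fun_eq_iff vec_eq_iff rs)
    moreover have "bij ?\<phi>"
      by (rule o_bij[where g = ?\<psi>]) (simp_all add: fun_eq_iff vec_eq_iff rs)
    ultimately have "bij (?\<phi> \<circ> g \<circ> ?\<psi>)" using g by (intro bij_comp)
    then show ?thesis by (simp add: G_def comp_def)
  qed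
  have derG: "(G has_derivative G' x) (at x)" for x
    unfolding G_def G'_def
    by (rule has_derivative_compose[OF _ bounded_linear_imp_has_derivative], rule has_derivative_compose[OF bounded_linear_imp_has_derivative der])
       (use lin linear_conv_bounded_linear in auto)
  have detG: "det (matrix (G' x)) = det (matrix (g' (?\<psi> x)))" for x
  proof -
    have ax: "?\<psi> (axis j 1) = axis (?r j) 1" for j
      by (auto simp: vec_eq_iff axis_def rs)
    have "matrix (G' x) = (\<chi> i j. matrix (g' (?\<psi> x)) $ ?r i $ ?r j)"
      by (simp add: matrix_def G'_def vec_eq_iff ax)
    then show ?thesis by (simp add: det_reindex[OF bij_Rep_ordered_copy])
  qed
  have "(\<integral>\<^sup>+ y. f y \<partial>lborel) = (\<integral>\<^sup>+ y. f (?\<psi> y) \<partial>lborel)"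
    by (rule lb) simp
  also have "\<dots> = (\<integral>\<^sup>+ x. f (?\<psi> (G x)) * ennreal \<bar>det (matrix (G' x))\<bar> \<partial>lborel)"
    by (rule nn_integral_change_of_variables_wellorder[OF bG derG]) (simp_all add: detG)
  also have "\<dots> = (\<integral>\<^sup>+ x. f (g (?\<psi> x)) * ennreal \<bar>det (matrix (g' (?\<psi> x)))\<bar> \<partial>lborel)"
    by (simp only: detG) (simp add: G_def rs)
  also have "\<dots> = (\<integral>\<^sup>+ x. f (g x) * ennreal \<bar>det (matrix (g' x))\<bar> \<partial>lborel)"
    by (rule lb[symmetric]) simp
  finally show ?thesis .
qed

section \<open>Smooth functions on the torus\<close>

lemma periodic_add_axis_int:
  fixes f :: "real^'n \<Rightarrow> 'b"
  assumes "periodic f"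
  shows "f (x + axis i (of_int m)) = f x"
proof -
  have ax: "axis i (a + c) = axis i a + (axis i c :: real^'n)" for a c
    by (simp add: vec_eq_iff axis_def)
  have nat: "f (x + axis i (of_nat n)) = f x" for n x
  proof (induction n)
    case (Suc n)
    have "f (x + axis i (of_nat (Suc n))) = f ((x + axis i (of_nat n)) + axis i 1)"
      by (simp add: ax add_ac)
    also have "\<dots> = f x" using assms Suc by (simp add: periodic_def)
    finally show ?case .
  qed (simp add: axis_def zero_vec_def[symmetric])
  show ?thesis
  proof (cases "m \<ge> 0")
    case True
    then show ?thesis using nat[of x "nat m"] by simp
  next
    case False
    have "(x + axis i (of_int m)) + axis i (of_nat (nat (- m))) = x"
      using False by (simp add: vec_eq_iff axis_def)
    then show ?thesis using nat[of "x + axis i (of_int m)" "nat (- m)"] by metis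
  qed
qed

definition int_vec :: "int^'n \<Rightarrow> real^'n" where
  "int_vec k = (\<chi> i. of_int (k $ i))"

lemma int_vec_nth [simp]: "int_vec k $ i = of_int (k $ i)"
  by (simp add: int_vec_def)

lemma periodic_add_int_vec:
  fixes f :: "real^'n \<Rightarrow> 'b"
  assumes "periodic f"
  shows "f (x + int_vec k) = f x"
proof -
  have "f (x + (\<Sum>i\<in>S. axis i (of_int (k $ i)))) = f x" if "finite S" for S
    using that
  proof (induction S)
    case (insert i S)
    have "f (x + (\<Sum>i\<in>insert i S. axis i (of_int (k $ i))))
        = f ((x + (\<Sum>i\<in>S. axis i (of_int (k $ i)))) + axis i (of_int (k $ i)))"
      using insert by (simp add: add_ac)
    then show ?case by (simp add: periodic_add_axis_int[OF assms] insert)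
  qed simp
  moreover have "int_vec k = (\<Sum>i\<in>UNIV. axis i (of_int (k $ i)))"
    by (simp add: vec_eq_iff axis_def sum.delta if_distrib cong: if_cong)
  ultimately show ?thesis by simp
qed

text \<open>
  Subtracting the integer parts of the coordinates moves every point into the compact cell.
\<close>

lemma periodic_bounded:
  fixes f :: "real^'n \<Rightarrow> real"
  assumes "periodic f" "continuous_on UNIV f"
  obtains M where "M \<ge> 0" "\<And>x. \<bar>f x\<bar> \<le> M"
proof -
  have "compact (f ` cbox 0 1)"
    using assms(2) by (intro compact_continuous_image compact_cbox) (auto intro: continuous_on_subset)
  then obtain M where M: "\<And>y. y \<in> f ` cbox 0 1 \<Longrightarrow> norm y \<le> M"
    by (meson compact_imp_bounded bounded_iff)
  have b: "\<bar>f x\<bar> \<le> M" for x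
  proof -
    let ?k = "(\<chi> i. - \<lfloor>x $ i\<rfloor>) :: int^'n"
    have "x + int_vec ?k \<in> cbox 0 1"
      by (auto simp: mem_box_cart intro: order.trans[OF less_imp_le[OF less_add_one]])
         linarith+
    then have "\<bar>f (x + int_vec ?k)\<bar> \<le> M"
      using M by (metis imageI real_norm_def)
    then show ?thesis by (simp add: periodic_add_int_vec[OF assms(1)])
  qed
  moreover have "M \<ge> 0" using b[of 0] by simp
  ultimately show ?thesis using that by blast
qed

lemma smooth_torusD:
  assumes "smooth_torus f"
  shows "periodic f" "continuous_on UNIV f" "f differentiable (at x)"
proof -
  have "Ck 0 f" "Ck (Suc 0) f" using assms by (auto simp: smooth_torus_def simp del: Ck.simps)
  then show "continuous_on UNIV f" "f differentiable (at x)" by auto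
qed (use assms in \<open>simp add: smooth_torus_def\<close>)

lemma has_derivative_grad:
  fixes f :: "real^'n \<Rightarrow> real"
  assumes "f differentiable (at x)"
  shows "(f has_derivative (\<lambda>h. grad f x \<bullet> h)) (at x)"
proof -
  let ?D = "frechet_derivative f (at x)"
  have D: "(f has_derivative ?D) (at x)" using assms by (simp add: frechet_derivative_works)
  then have lin: "linear ?D" by (rule has_derivative_linear)
  have "?D h = grad f x \<bullet> h" for h
  proof -
    have "?D h = ?D (\<Sum>i\<in>UNIV. h $ i *\<^sub>R axis i 1)"
      by (simp add: basis_expansion scalar_mult_eq_scaleR[symmetric])
    also have "\<dots> = (\<Sum>i\<in>UNIV. h $ i * ?D (axis i 1))"
      using lin by (simp add: linear_sum linear_scale)
    also have "\<dots> = grad f x \<bullet> h"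
      by (simp add: inner_vec_def grad_def partial_def mult.commute)
    finally show ?thesis .
  qed
  then have "?D = (\<lambda>h. grad f x \<bullet> h)" by blast
  with D show ?thesis by simp
qed

lemma smooth_torus_partial:
  fixes f :: "real^'n \<Rightarrow> real"
  assumes "smooth_torus f"
  shows "smooth_torus (partial i f)"
proof -
  have "frechet_derivative f (at (x + axis j 1)) = frechet_derivative f (at x)" for x j
  proof -
    have "(f has_derivative frechet_derivative f (at (x + axis j 1))) (at (x + axis j 1))"
      using smooth_torusD(3)[OF assms] by (simp add: frechet_derivative_works)
    then have "((\<lambda>y. f (y + axis j 1)) has_derivative frechet_derivative f (at (x + axis j 1))) (at x)"
      by (rule has_derivative_compose[rotated]) (auto intro!: derivative_eq_intros)
    then have "(f has_derivative frechet_derivative f (at (x + axis j 1))) (at x)"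
      using smooth_torusD(1)[OF assms] by (simp add: periodic_def)
    then show ?thesis by (simp add: frechet_derivative_at)
  qed
  then have "periodic (partial i f)" by (simp add: periodic_def partial_def)
  moreover have "Ck k (partial i f)" for k
    using assms[unfolded smooth_torus_def] by (metis Ck.simps(2))
  ultimately show ?thesis by (simp add: smooth_torus_def)
qed

lemma smooth_torus_lipschitz:
  fixes f :: "real^'n \<Rightarrow> real"
  assumes "smooth_torus f"
  obtains L where "L \<ge> 0" "\<And>x y. \<bar>f x - f y\<bar> \<le> L * norm (x - y)"
proof -
  have "\<exists>M\<ge>0. \<forall>x. \<bar>partial i f x\<bar> \<le> M" for i
    using periodic_bounded smooth_torusD smooth_torus_partial[OF assms] by metis
  then obtain M where M: "\<And>i. M i \<ge> 0" "\<And>i x. \<bar>partial i f x\<bar> \<le> M i" by metis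
  let ?L = "\<Sum>i\<in>UNIV. M i"
  have "norm (grad f x) \<le> ?L" for x
    using norm_le_l1_cart[of "grad f x"] sum_mono[of UNIV "\<lambda>i. \<bar>partial i f x\<bar>" M] M(2)
    by (force simp: grad_def)
  then have on: "onorm (\<lambda>h. grad f x \<bullet> h) \<le> ?L" for x
    by (intro onorm_le) (metis Cauchy_Schwarz_ineq2 mult_right_mono norm_ge_zero order_trans real_norm_def)
  have "norm (f x - f y) \<le> ?L * norm (x - y)" for x y
    by (rule differentiable_bound[of UNIV f "\<lambda>x h. grad f x \<bullet> h"])
       (use on has_derivative_grad smooth_torusD(3)[OF assms] in auto)
  then show ?thesis using that[of ?L] M(1) by (simp add: sum_nonneg)
qed

lemma norm_matrix_vector_le:
  fixes A :: "real^'n^'m"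
  shows "norm (A *v h) \<le> (\<Sum>i\<in>UNIV. \<Sum>j\<in>UNIV. \<bar>A $ i $ j\<bar>) * norm h"
proof -
  have "norm (A *v h) \<le> (\<Sum>i\<in>UNIV. \<bar>(A *v h) $ i\<bar>)" by (rule norm_le_l1_cart)
  also have "\<dots> \<le> (\<Sum>i\<in>UNIV. \<Sum>j\<in>UNIV. \<bar>A $ i $ j\<bar> * norm h)"
  proof (rule sum_mono)
    fix i
    have "\<bar>(A *v h) $ i\<bar> \<le> (\<Sum>j\<in>UNIV. \<bar>A $ i $ j * h $ j\<bar>)"
      by (simp add: matrix_vector_mult_def)
    also have "\<dots> \<le> (\<Sum>j\<in>UNIV. \<bar>A $ i $ j\<bar> * norm h)"
      by (rule sum_mono) (simp add: abs_mult mult_left_mono component_le_norm_cart)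
    finally show "\<bar>(A *v h) $ i\<bar> \<le> (\<Sum>j\<in>UNIV. \<bar>A $ i $ j\<bar> * norm h)" .
  qed
  finally show ?thesis by (simp add: sum_distrib_right)
qed

lemma has_derivative_hessian:
  fixes V :: "real^'n \<Rightarrow> real"
  assumes "smooth_torus V"
  shows "(grad V has_derivative (\<lambda>h. hessian V x *v h)) (at x)"
    and "hessian V x $ i $ j = partial j (partial i V) x"
proof -
  let ?H = "\<chi> i j. partial j (partial i V) x"
  have "((\<lambda>y. \<chi> i. partial i V y) has_derivative (\<lambda>h. \<chi> i. grad (partial i V) x \<bullet> h)) (at x)"
    by (subst has_derivative_componentwise_within)
       (auto simp: Basis_vec_def inner_axis
          intro!: has_derivative_grad smooth_torusD(3) smooth_torus_partial assms)
  moreover have "(\<lambda>y. \<chi> i. partial i V y) = grad V" by (simp add: fun_eq_iff grad_def)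
  moreover have "(\<lambda>h. \<chi> i. grad (partial i V) x \<bullet> h) = (\<lambda>h. ?H *v h)"
    by (simp add: fun_eq_iff vec_eq_iff inner_vec_def grad_def matrix_vector_mult_def)
  ultimately have D: "(grad V has_derivative (\<lambda>h. ?H *v h)) (at x)" by simp
  then have "hessian V x = ?H"
    unfolding hessian_def jacobian_def
    by (metis frechet_derivative_at matrix_of_matrix_vector_mul)
  with D show "(grad V has_derivative (\<lambda>h. hessian V x *v h)) (at x)"
    and "hessian V x $ i $ j = partial j (partial i V) x" by simp_all
qed

text \<open>
  These global bounds, which hold because all partial derivatives are continuous and periodic, are
  everything that the analysis of the flow needs to know about the field.
\<close>

lemma grad_bounds:
  fixes V :: "real^'n \<Rightarrow> real"
  assumes "smooth_torus V"
  obtains M L C where "M \<ge> 0" "L \<ge> 0" "C \<ge> 0"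
    "\<And>x. norm (grad V x) \<le> M"
    "\<And>x h. norm (hessian V x *v h) \<le> L * norm h"
    "\<And>x y h. norm ((hessian V x - hessian V y) *v h) \<le> C * norm (x - y) * norm h"
proof -
  note sm = smooth_torus_partial
  have "\<exists>M\<ge>0. \<forall>x. \<bar>partial i V x\<bar> \<le> M" for i
    using periodic_bounded smooth_torusD sm[OF assms] by metis
  then obtain M where M: "\<And>i. M i \<ge> 0" "\<And>i x. \<bar>partial i V x\<bar> \<le> M i" by metis
  have "\<forall>i j. \<exists>L. L \<ge> 0 \<and> (\<forall>x. \<bar>partial j (partial i V) x\<bar> \<le> L)"
    using periodic_bounded smooth_torusD sm[OF sm[OF assms]] by metis
  then obtain L where L: "\<And>i j. L i j \<ge> 0" "\<And>i j x. \<bar>partial j (partial i V) x\<bar> \<le> L i j"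
    unfolding choice_iff by blast
  have "\<forall>i j. \<exists>C. C \<ge> 0 \<and> (\<forall>x y. \<bar>partial j (partial i V) x - partial j (partial i V) y\<bar> \<le> C * norm (x - y))"
    using smooth_torus_lipschitz[OF sm[OF sm[OF assms]]] by metis
  then obtain C where C: "\<And>i j. C i j \<ge> 0"
    "\<And>i j x y. \<bar>partial j (partial i V) x - partial j (partial i V) y\<bar> \<le> C i j * norm (x - y)"
    unfolding choice_iff by blast
  have 1: "norm (grad V x) \<le> (\<Sum>i\<in>UNIV. M i)" for x
    using norm_le_l1_cart[of "grad V x"] sum_mono[of UNIV "\<lambda>i. \<bar>partial i V x\<bar>" M] M(2)
    by (force simp: grad_def)
  have 2: "norm (hessian V x *v h) \<le> (\<Sum>i\<in>UNIV. \<Sum>j\<in>UNIV. L i j) * norm h" for x h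
    by (rule order_trans[OF norm_matrix_vector_le])
       (auto intro!: mult_right_mono sum_mono simp: has_derivative_hessian[OF assms] L)
  have 3: "norm ((hessian V x - hessian V y) *v h) \<le> (\<Sum>i\<in>UNIV. \<Sum>j\<in>UNIV. C i j) * norm (x - y) * norm h" for x y h
    by (rule order_trans[OF norm_matrix_vector_le], rule mult_right_mono)
       (auto intro!: sum_mono simp: has_derivative_hessian[OF assms] C sum_distrib_right)
  show ?thesis
    by (rule that[OF _ _ _ 1 2 3]) (auto intro!: sum_nonneg simp: M L C)
qed

section \<open>Tools: almost linear maps, Gronwall's inequality, derivative of the determinant\<close>

lemma has_derivative_quadratic_remainder:
  assumes "bounded_linear D" "0 < e"
    and "\<And>y. norm (y - x) < e \<Longrightarrow> norm (f y - f x - D (y - x)) \<le> c * (norm (y - x))\<^sup>2"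
  shows "(f has_derivative D) (at x)"
proof (rule has_derivativeI_sandwich[where e = e and H = "\<lambda>y. c * norm (y - x)"])
  fix y assume "y \<noteq> x" "dist y x < e"
  then have "norm (f y - f x - D (y - x)) / norm (y - x) \<le> (c * (norm (y - x))\<^sup>2) / norm (y - x)"
    using assms(3)[of y] by (intro divide_right_mono) (auto simp: dist_norm)
  also have "\<dots> = c * norm (y - x)" using \<open>y \<noteq> x\<close> by (simp add: power2_eq_square)
  finally show "norm (f y - f x - D (y - x)) / norm (y - x) \<le> c * norm (y - x)" .
next
  have "((\<lambda>y. c * norm (y - x)) \<longlongrightarrow> c * norm (x - x)) (at x)" by (intro tendsto_intros)
  then show "((\<lambda>y. c * norm (y - x)) \<longlongrightarrow> 0) (at x)" by simp
qed (use assms in auto)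

lemma LIMSEQ_const_times_inverse_Suc: "(\<lambda>n. c * inverse (real (Suc n))) \<longlonglongrightarrow> 0"
  using tendsto_mult_right_zero[OF LIMSEQ_inverse_real_of_nat] .

text \<open>
  A criterion for differentiability at $0$ that does not presuppose the derivative. The hypothesis says that
  \<open>q\<close> respects linear relations up to a quadratic error. Applied to the relation between $h/m$ and $h/n$
  it makes the rescaled values $n \, q(h/n)$ a Cauchy sequence; applied to sums and multiples it makes
  their limit linear; and the case $n = 1$ bounds the remainder. For flows this replaces the solution theory
  of the linearised equation.
\<close>

lemma almost_linear_limit:
  fixes q :: "'a::euclidean_space \<Rightarrow> 'b::euclidean_space"
  assumes q: "\<And>c1 c2 c3 h1 h2 h3. c1 *\<^sub>R h1 + c2 *\<^sub>R h2 + c3 *\<^sub>R h3 = 0 \<Longrightarrow>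
      norm (c1 *\<^sub>R q h1 + c2 *\<^sub>R q h2 + c3 *\<^sub>R q h3)
        \<le> C * (\<bar>c1\<bar> * (norm h1)\<^sup>2 + \<bar>c2\<bar> * (norm h2)\<^sup>2 + \<bar>c3\<bar> * (norm h3)\<^sup>2)"
  obtains A where "linear A" "\<And>h. norm (q h - A h) \<le> C * (norm h)\<^sup>2"
    "\<And>h. (\<lambda>n. real (Suc n) *\<^sub>R q (inverse (real (Suc n)) *\<^sub>R h)) \<longlonglongrightarrow> A h"
proof -
  define w where "w h n = real (Suc n) *\<^sub>R q (inverse (real (Suc n)) *\<^sub>R h)" for h n
  have sq: "r * (norm (inverse r *\<^sub>R h))\<^sup>2 = (norm h)\<^sup>2 * inverse r" if "r > 0" for r and h :: 'a
    using that by (simp add: power_mult_distrib power2_eq_square field_simps)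
  have sq': "\<bar>real (Suc n)\<bar> * (norm (inverse (real (Suc n)) *\<^sub>R h))\<^sup>2 = (norm h)\<^sup>2 * inverse (real (Suc n))"
    "\<bar>- real (Suc n)\<bar> * (norm (inverse (real (Suc n)) *\<^sub>R h))\<^sup>2 = (norm h)\<^sup>2 * inverse (real (Suc n))" for n and h :: 'a
    using sq[of "real (Suc n)" h] by (simp_all del: of_nat_Suc)
  have step: "norm (w h m - w h n) \<le> C * (norm h)\<^sup>2 * (inverse (real (Suc m)) + inverse (real (Suc n)))" for h m n
    using q[of "real (Suc m)" "inverse (real (Suc m)) *\<^sub>R h" "- real (Suc n)" "inverse (real (Suc n)) *\<^sub>R h" 0 0]
    unfolding sq' by (simp add: w_def sq' algebra_simps del: of_nat_Suc)
  have "convergent (w h)" for h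
  proof (rule Cauchy_convergent, rule metric_CauchyI)
    fix e :: real assume "e > 0"
    have C: "C * (norm h)\<^sup>2 \<ge> 0"
      using order_trans[OF norm_ge_zero step[of h 0 0]] by simp
    obtain N where N: "C * (norm h)\<^sup>2 * inverse (real (Suc N)) < e / 2"
      using order_tendstoD(2)[OF LIMSEQ_const_times_inverse_Suc, of "e / 2"] \<open>e > 0\<close>
      unfolding eventually_sequentially by (metis half_gt_zero_iff order_refl)
    have "dist (w h m) (w h n) < e" if "m \<ge> N" "n \<ge> N" for m n
    proof -
      have "inverse (real (Suc m)) + inverse (real (Suc n)) \<le> 2 * inverse (real (Suc N))"
        unfolding mult_2 using that by (intro add_mono le_imp_inverse_le) auto
      then have "norm (w h m - w h n) \<le> C * (norm h)\<^sup>2 * (2 * inverse (real (Suc N)))"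
        using step[of h m n] C by (meson mult_left_mono order_trans)
      with N show ?thesis by (simp add: dist_norm)
    qed
    then show "\<exists>N. \<forall>m\<ge>N. \<forall>n\<ge>N. dist (w h m) (w h n) < e" by blast
  qed
  then obtain A where A: "\<And>h. w h \<longlonglongrightarrow> A h"
    unfolding convergent_def by metis
  have null: "F = 0" if "f \<longlonglongrightarrow> F" "\<And>n. norm (f n) \<le> c * inverse (real (Suc n))" for f :: "nat \<Rightarrow> 'b" and F c
  proof (rule LIMSEQ_unique[OF that(1)])
    show "f \<longlonglongrightarrow> 0"
      by (rule Lim_null_comparison[OF _ LIMSEQ_const_times_inverse_Suc[of c]]) (use that(2) in auto)
  qed
  \<comment> \<open>Rescaling by $n$ turns the quadratic error into one of order $1/n$, so the limit \<open>A\<close> satisfies linear relations exactly.\<close>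
  have comb: "norm (c1 *\<^sub>R w h1 n + c2 *\<^sub>R w h2 n + c3 *\<^sub>R w h3 n)
      \<le> (C * (\<bar>c1\<bar> * (norm h1)\<^sup>2 + \<bar>c2\<bar> * (norm h2)\<^sup>2 + \<bar>c3\<bar> * (norm h3)\<^sup>2)) * inverse (real (Suc n))"
    if c: "c1 *\<^sub>R h1 + c2 *\<^sub>R h2 + c3 *\<^sub>R h3 = 0" for c1 c2 c3 h1 h2 h3 n
  proof -
    define r where "r = real (Suc n)"
    have r: "r > 0" by (simp add: r_def)
    have eq: "(c * r) *\<^sub>R q (inverse r *\<^sub>R h) = c *\<^sub>R w h n"
      "(c * r) *\<^sub>R (inverse r *\<^sub>R h) = c *\<^sub>R h"
      "\<bar>c * r\<bar> * (norm (inverse r *\<^sub>R h))\<^sup>2 = \<bar>c\<bar> * (norm h)\<^sup>2 * inverse r" for c h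
      using r sq[OF r, of h] by (simp_all add: w_def r_def[symmetric] abs_mult mult.assoc del: norm_scaleR of_nat_Suc)
    show ?thesis
      using q[of "c1 * r" "inverse r *\<^sub>R h1" "c2 * r" "inverse r *\<^sub>R h2" "c3 * r" "inverse r *\<^sub>R h3"] c
      unfolding eq r_def[symmetric] by (simp only: distrib_right mult.assoc)
  qed
  have "linear A"
  proof
    fix h k :: 'a and r :: real
    have "(\<lambda>n. w (h + k) n - w h n - w k n) \<longlonglongrightarrow> A (h + k) - A h - A k"
      by (intro tendsto_intros A)
    moreover have "norm (w (h + k) n - w h n - w k n)
        \<le> (C * ((norm (h + k))\<^sup>2 + (norm h)\<^sup>2 + (norm k)\<^sup>2)) * inverse (real (Suc n))" for n
      using comb[of 1 "h + k" "-1" h "-1" k n] by (simp del: of_nat_Suc)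
    ultimately have "A (h + k) - A h - A k = 0" by (rule null)
    then show "A (h + k) = A h + A k" by (simp add: algebra_simps)
    have "(\<lambda>n. w (r *\<^sub>R h) n - r *\<^sub>R w h n) \<longlonglongrightarrow> A (r *\<^sub>R h) - r *\<^sub>R A h"
      by (intro tendsto_intros A)
    moreover have "norm (w (r *\<^sub>R h) n - r *\<^sub>R w h n)
        \<le> (C * ((norm (r *\<^sub>R h))\<^sup>2 + \<bar>r\<bar> * (norm h)\<^sup>2)) * inverse (real (Suc n))" for n
      using comb[of 1 "r *\<^sub>R h" "- r" h 0 0 n] by (simp del: of_nat_Suc)
    ultimately have "A (r *\<^sub>R h) - r *\<^sub>R A h = 0" by (rule null)
    then show "A (r *\<^sub>R h) = r *\<^sub>R A h" by simp
  qed
  moreover have "norm (q h - A h) \<le> C * (norm h)\<^sup>2" for h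
  proof (rule LIMSEQ_le)
    show "(\<lambda>n. norm (w h 0 - w h n)) \<longlonglongrightarrow> norm (q h - A h)"
      using tendsto_norm[OF tendsto_diff[OF tendsto_const A]] by (simp add: w_def)
    have "(\<lambda>n. C * (norm h)\<^sup>2 + C * (norm h)\<^sup>2 * inverse (real (Suc n))) \<longlonglongrightarrow> C * (norm h)\<^sup>2 + 0"
      by (intro tendsto_add tendsto_const LIMSEQ_const_times_inverse_Suc)
    then show "(\<lambda>n. C * (norm h)\<^sup>2 + C * (norm h)\<^sup>2 * inverse (real (Suc n))) \<longlonglongrightarrow> C * (norm h)\<^sup>2"
      by simp
    show "\<exists>N. \<forall>n\<ge>N. norm (w h 0 - w h n) \<le> C * (norm h)\<^sup>2 + C * (norm h)\<^sup>2 * inverse (real (Suc n))"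
      using step[of h 0] by (simp add: distrib_left)
  qed
  ultimately show ?thesis using that A unfolding w_def by blast
qed

text \<open>
  The squared norm is used because it is differentiable also where \<open>u\<close> vanishes. By $2 e |u| \le |u|^2 + e^2$
  the function $|u|^2 + e^2$ grows at most with rate $2L + 1$.
\<close>

lemma gronwall_forward:
  fixes u :: "real \<Rightarrow> 'a::real_inner"
  assumes t: "0 \<le> t" and L: "0 \<le> L" and e: "0 \<le> e"
    and u: "\<And>s. 0 \<le> s \<Longrightarrow> s \<le> t \<Longrightarrow> (u has_vector_derivative u' s) (at s)"
    and bound: "\<And>s. 0 \<le> s \<Longrightarrow> s \<le> t \<Longrightarrow> norm (u' s) \<le> L * norm (u s) + e"
  shows "norm (u t) \<le> (norm (u 0) + e) * exp ((L + 1) * t)"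
proof -
  \<comment> \<open>The exponential factor cancels the growth rate $2L + 1$, so \<open>\<phi>\<close> cannot increase.\<close>
  define \<phi> where "\<phi> s = (u s \<bullet> u s + e\<^sup>2) * exp (- (2 * L + 1) * s)" for s
  have "\<phi> t \<le> \<phi> 0"
  proof (rule DERIV_nonpos_imp_nonincreasing[OF t])
    fix s assume s: "0 \<le> s" "s \<le> t"
    have "((\<lambda>s. u s \<bullet> u s) has_real_derivative 2 * (u s \<bullet> u' s)) (at s)"
      unfolding has_field_derivative_def
      by (rule has_derivative_eq_rhs[OF has_derivative_inner[OF u[OF s, unfolded has_vector_derivative_def]
            u[OF s, unfolded has_vector_derivative_def]]])
         (simp add: fun_eq_iff inner_commute)
    then have "(\<phi> has_real_derivative (2 * (u s \<bullet> u' s) - (2 * L + 1) * (u s \<bullet> u s + e\<^sup>2)) * exp (- (2 * L + 1) * s)) (at s)"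
      unfolding \<phi>_def by (auto intro!: derivative_eq_intros simp: algebra_simps)
    moreover have "2 * (u s \<bullet> u' s) - (2 * L + 1) * (u s \<bullet> u s + e\<^sup>2) \<le> 0"
    proof -
      have "u s \<bullet> u' s \<le> norm (u s) * (L * norm (u s) + e)"
        using bound[OF s] by (meson norm_cauchy_schwarz mult_left_mono norm_ge_zero order_trans)
      moreover have "0 \<le> (norm (u s) - e)\<^sup>2" by simp
      moreover have "0 \<le> L * e\<^sup>2" using L by simp
      ultimately show ?thesis
        by (simp add: dot_square_norm power2_eq_square algebra_simps)
    qed
    ultimately show "\<exists>y. (\<phi> has_real_derivative y) (at s) \<and> y \<le> 0"
      by (meson exp_ge_zero mult_nonpos_nonneg)
  qed
  then have "(u t \<bullet> u t + e\<^sup>2) * exp (- (2 * L + 1) * t) * exp ((2 * L + 1) * t) \<le> (u 0 \<bullet> u 0 + e\<^sup>2) * exp ((2 * L + 1) * t)"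
    unfolding \<phi>_def by (intro mult_right_mono) auto
  then have "u t \<bullet> u t + e\<^sup>2 \<le> (u 0 \<bullet> u 0 + e\<^sup>2) * exp ((2 * L + 1) * t)"
    by (simp add: mult.assoc exp_add[symmetric] algebra_simps)
  also have "\<dots> \<le> (norm (u 0) + e)\<^sup>2 * exp ((L + 1) * t + (L + 1) * t)"
    using e t by (intro mult_mono) (auto simp: dot_square_norm power2_sum algebra_simps)
  finally have "(norm (u t))\<^sup>2 \<le> ((norm (u 0) + e) * exp ((L + 1) * t))\<^sup>2"
    unfolding exp_add by (simp add: dot_square_norm power2_eq_square algebra_simps) (smt (verit) zero_le_square)
  then show ?thesis by (rule power2_le_imp_le) (use e in auto)
qed

lemma gronwall:
  fixes u :: "real \<Rightarrow> 'a::real_inner"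
  assumes L: "0 \<le> L" and e: "0 \<le> e"
    and u: "\<And>s. \<bar>s\<bar> \<le> \<bar>t\<bar> \<Longrightarrow> (u has_vector_derivative u' s) (at s)"
    and bound: "\<And>s. \<bar>s\<bar> \<le> \<bar>t\<bar> \<Longrightarrow> norm (u' s) \<le> L * norm (u s) + e"
  shows "norm (u t) \<le> (norm (u 0) + e) * exp ((L + 1) * \<bar>t\<bar>)"
proof (cases "0 \<le> t")
  case True
  then show ?thesis using gronwall_forward[of t L e u u'] assms by auto
next
  case False
  have "((\<lambda>s. u (- s)) has_vector_derivative - u' (- s)) (at s)" if "\<bar>s\<bar> \<le> \<bar>t\<bar>" for s
    using vector_diff_chain_at[of uminus "-1" s u "u' (- s)"] u[of "- s"] that
    by (auto simp: comp_def has_vector_derivative_def intro!: derivative_eq_intros)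
  then show ?thesis
    using gronwall_forward[of "- t" L e "\<lambda>s. u (- s)" "\<lambda>s. - u' (- s)"] False L e bound by auto
qed

lemma vector_mean_value_bound:
  fixes v :: "real \<Rightarrow> 'a::real_normed_vector"
  assumes v: "\<And>s. \<bar>s\<bar> \<le> \<bar>t\<bar> \<Longrightarrow> (v has_vector_derivative v' s) (at s)"
    and bound: "\<And>s. \<bar>s\<bar> \<le> \<bar>t\<bar> \<Longrightarrow> norm (v' s) \<le> c"
  shows "norm (v t - v 0) \<le> c * \<bar>t\<bar>"
proof -
  have "norm (v t - v 0) \<le> c * norm (t - 0)"
  proof (rule differentiable_bound[where S = "{- \<bar>t\<bar>..\<bar>t\<bar>}" and f' = "\<lambda>s h. h *\<^sub>R v' s"])
    fix s assume "s \<in> {- \<bar>t\<bar>..\<bar>t\<bar>}"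
    then have s: "\<bar>s\<bar> \<le> \<bar>t\<bar>" by auto
    then show "(v has_derivative (\<lambda>h. h *\<^sub>R v' s)) (at s within {- \<bar>t\<bar>..\<bar>t\<bar>})"
      using v has_vector_derivative_def has_derivative_at_withinI by blast
    show "onorm (\<lambda>h. h *\<^sub>R v' s) \<le> c"
      using bound[OF s] by (intro onorm_le) (simp add: mult.commute[of c] mult_left_mono)
  qed auto
  then show ?thesis by simp
qed

text \<open>
  In the Leibniz formula only the identity permutation contributes: any other permutation moves at least two
  indices, so each of its products keeps a vanishing factor after one factor has been differentiated.
\<close>

lemma det_has_derivative_at_identity:
  fixes A :: "real \<Rightarrow> real^'n^'n"
  assumes A: "\<And>i j. ((\<lambda>s. A s $ i $ j) has_real_derivative N $ i $ j) (at t)"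
    and id: "A t = mat 1"
  shows "((\<lambda>s. det (A s)) has_real_derivative trace N) (at t)"
proof -
  let ?d = "\<lambda>p. (\<Sum>i\<in>UNIV. N $ i $ p i * (\<Prod>j\<in>UNIV - {i}. A t $ j $ p j))"
  have "((\<lambda>s. det (A s)) has_real_derivative
      (\<Sum>p | p permutes (UNIV::'n set). of_int (sign p) * ?d p)) (at t)"
    unfolding det_def
    by (intro DERIV_sum DERIV_cmult has_field_derivative_prod A)
  moreover have "?d p = 0" if p: "p permutes UNIV" "p \<noteq> id" for p
  proof (rule sum.neutral, safe)
    fix i
    obtain k where k: "p k \<noteq> k" using p by (auto simp: fun_eq_iff)
    \<comment> \<open>If \<open>p\<close> moves \<open>k\<close>, it moves \<open>p k\<close> too, so a moved index different from \<open>i\<close> exists.\<close>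
    have "p (p k) \<noteq> p k" using k permutes_inj[OF p(1)] by (metis injD)
    with k obtain j where "j \<noteq> i" "p j \<noteq> j" by metis
    then have "(\<Prod>j\<in>UNIV - {i}. A t $ j $ p j) = 0"
      by (intro prod_zero) (auto simp: id mat_def intro!: bexI[of _ j])
    then show "N $ i $ p i * (\<Prod>j\<in>UNIV - {i}. A t $ j $ p j) = 0" by simp
  qed
  then have "(\<Sum>p | p permutes (UNIV::'n set). of_int (sign p) * ?d p)
      = (\<Sum>p \<in> {id}. of_int (sign p) * ?d p)"
    by (intro sum.mono_neutral_right) (auto simp: permutes_id finite_permutations)
  moreover have "?d id = trace N"
    by (simp add: trace_def id mat_def)
  ultimately show ?thesis by simp
qed

section \<open>Differentiability of flows and Liouville's formula\<close>

text \<open>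
  The flow of a bounded field whose derivative \<open>B\<close> is bounded and Lipschitz. Working with these constants
  keeps periodicity and the gradient structure out of the analysis of the flow.
\<close>

locale smooth_flow =
  fixes b :: "real^'n \<Rightarrow> real^'n" and B :: "real^'n \<Rightarrow> real^'n^'n"
    and M L C :: real and X :: "real \<Rightarrow> real^'n \<Rightarrow> real^'n"
  assumes nonneg: "0 \<le> M" "0 \<le> L" "0 \<le> C"
    and b_deriv: "\<And>x. (b has_derivative (\<lambda>h. B x *v h)) (at x)"
    and b_bound: "\<And>x. norm (b x) \<le> M"
    and B_bound: "\<And>x h. norm (B x *v h) \<le> L * norm h"
    and B_lipschitz: "\<And>x y h. norm ((B x - B y) *v h) \<le> C * norm (x - y) * norm h"
    and flow: "is_flow b X"
begin

lemma flow_0 [simp]: "X 0 x = x"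
  and flow_deriv: "((\<lambda>s. X s x) has_vector_derivative b (X t x)) (at t)"
  using flow by (auto simp: is_flow_def)

lemma b_lipschitz: "norm (b x - b y) \<le> L * norm (x - y)"
  by (rule differentiable_bound[of UNIV b "\<lambda>x h. B x *v h"])
     (auto intro!: onorm_le B_bound b_deriv)

lemma b_taylor: "norm (b y - b x - B x *v (y - x)) \<le> C * (norm (y - x))\<^sup>2"
proof -
  \<comment> \<open>The derivative \<open>B z - B x\<close> of \<open>?g\<close> is at most $C |y - x|$ on the ball, which gives the second factor $|y - x|$.\<close>
  let ?g = "\<lambda>z. b z - B x *v z"
  have "norm (?g y - ?g x) \<le> (C * norm (y - x)) * norm (y - x)"
  proof (rule differentiable_bound[where S = "cball x (norm (y - x))" and f' = "\<lambda>z h. (B z - B x) *v h"])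
    fix z assume z: "z \<in> cball x (norm (y - x))"
    show "(?g has_derivative (\<lambda>h. (B z - B x) *v h)) (at z within cball x (norm (y - x)))"
      by (rule has_derivative_at_withinI)
         (auto intro!: derivative_eq_intros b_deriv bounded_linear_imp_has_derivative simp: matrix_vector_mult_diff_rdistrib)
    have "norm ((B z - B x) *v h) \<le> C * norm (y - x) * norm h" for h
      using z nonneg by (intro order_trans[OF B_lipschitz] mult_right_mono mult_left_mono)
        (auto simp: dist_norm norm_minus_commute)
    then show "onorm (\<lambda>h. (B z - B x) *v h) \<le> C * norm (y - x)"
      by (rule onorm_le)
  qed (auto simp: dist_norm norm_minus_commute)
  then show ?thesis
    by (simp add: power2_eq_square matrix_vector_mult_diff_distrib algebra_simps)
qed

text \<open>
  The constant is $L + 1$ rather than $L$ because that is the rate which \<open>gronwall\<close> delivers.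
\<close>

definition growth :: "real \<Rightarrow> real" where "growth t = exp ((L + 1) * \<bar>t\<bar>)"

lemma growth_ge_1: "1 \<le> growth t"
  using nonneg by (simp add: growth_def)

lemma growth_mono: "\<bar>s\<bar> \<le> \<bar>t\<bar> \<Longrightarrow> growth s \<le> growth t"
  using nonneg by (simp add: growth_def mult_left_mono)

text \<open>
  The curve \<open>u\<close> is an arbitrary solution: besides the Lipschitz dependence on the initial point this yields
  uniqueness, and with it the group law and the equivariance under lattice translations.
\<close>

lemma trajectory_lipschitz:
  assumes u: "\<And>s. (u has_vector_derivative b (u s)) (at s)"
  shows "norm (u t - X t x) \<le> norm (u 0 - x) * growth t"
proof -
  have "norm (u t - X t x) \<le> (norm (u 0 - X 0 x) + 0) * exp ((L + 1) * \<bar>t\<bar>)"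
    by (rule gronwall[where u' = "\<lambda>s. b (u s) - b (X s x)"])
       (auto intro!: nonneg has_vector_derivative_diff u flow_deriv b_lipschitz)
  then show ?thesis by (simp add: growth_def)
qed

lemma trajectory_unique:
  assumes "\<And>s. (u has_vector_derivative b (u s)) (at s)"
  shows "u t = X t (u 0)"
  using trajectory_lipschitz[OF assms, of t "u 0"] by simp

lemma flow_lipschitz: "norm (X t x - X t y) \<le> norm (x - y) * growth t"
  using trajectory_lipschitz[OF flow_deriv, of t x y] by simp

lemma flow_speed: "norm (X t x - X s x) \<le> M * \<bar>t - s\<bar>"
proof -
  have "norm (X t x - X s x) \<le> M * norm (t - s)"
    by (rule differentiable_bound[of UNIV _ "\<lambda>t h. h *\<^sub>R b (X t x)"])
       (auto intro!: onorm_le flow_deriv[unfolded has_vector_derivative_def] simp: mult.commute[of M] mult_left_mono b_bound)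
  then show ?thesis by simp
qed

lemma flow_add: "X (s + t) x = X s (X t x)"
proof -
  have "((\<lambda>s. X (s + t) x) has_vector_derivative b (X (s + t) x)) (at s)" for s
  proof -
    have "((\<lambda>s. s + t) has_vector_derivative 1) (at s)"
      by (auto simp: has_vector_derivative_def intro!: derivative_eq_intros)
    from vector_diff_chain_at[OF this flow_deriv] show ?thesis by (simp add: comp_def)
  qed
  from trajectory_unique[OF this, of s] show ?thesis by simp
qed

lemma flow_uminus [simp]: "X (- t) (X t x) = x" "X t (X (- t) x) = x"
  using flow_add[of "- t" t x] flow_add[of t "- t" x] by simp_all

lemma flow_bij: "bij (X t)"
  by (rule o_bij[where g = "X (- t)"]) (simp_all add: fun_eq_iff)

lemma flow_continuous: "continuous_on UNIV (\<lambda>(t, x). X t x)"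
  unfolding continuous_on_def
proof (clarsimp, rule Lim_null[THEN iffD2])
  fix t x
  have "\<forall>\<^sub>F p in at (t, x). norm ((case p of (s, y) \<Rightarrow> X s y) - X t x)
      \<le> M * \<bar>fst p - t\<bar> + norm (snd p - x) * growth t"
  proof (intro always_eventually allI)
    fix p :: "real \<times> (real^'n)"
    have "norm (X (fst p) (snd p) - X t x)
        \<le> norm (X (fst p) (snd p) - X t (snd p)) + norm (X t (snd p) - X t x)"
      by (rule norm_diff_triangle_le[OF order_refl order_refl])
    also have "\<dots> \<le> M * \<bar>fst p - t\<bar> + norm (snd p - x) * growth t"
      by (intro add_mono flow_speed flow_lipschitz)
    finally show "norm ((case p of (s, y) \<Rightarrow> X s y) - X t x)
      \<le> M * \<bar>fst p - t\<bar> + norm (snd p - x) * growth t"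
      by (simp add: case_prod_beta)
  qed
  moreover have "((\<lambda>p. M * \<bar>fst p - t\<bar> + norm (snd p - x) * growth t) \<longlongrightarrow>
      M * \<bar>fst (t, x) - t\<bar> + norm (snd (t, x) - x) * growth t) (at (t, x))"
    by (intro tendsto_intros)
  then have "((\<lambda>p. M * \<bar>fst p - t\<bar> + norm (snd p - x) * growth t) \<longlongrightarrow> 0) (at (t, x))"
    by simp
  ultimately show "((\<lambda>p. (case p of (s, y) \<Rightarrow> X s y) - X t x) \<longlongrightarrow> 0) (at (t, x))"
    by (rule Lim_null_comparison)
qed

lemma continuous_on_flow:
  assumes "continuous_on S f" "continuous_on S g"
  shows "continuous_on S (\<lambda>p. X (f p) (g p))"
  using continuous_on_compose2[OF flow_continuous continuous_on_Pair[OF assms]] by simp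

text \<open>
  A combination of increments of the flow solves the linearised equation up to the Taylor remainders
  of \<open>b\<close>, which are quadratic in the increments. A linear relation between the $h_i$ makes its initial value
  vanish, so the inequality of Gronwall leaves only the remainders.
\<close>

lemma flow_almost_linear:
  assumes "c1 *\<^sub>R h1 + c2 *\<^sub>R h2 + c3 *\<^sub>R h3 = 0"
  shows "norm (c1 *\<^sub>R (X t (x + h1) - X t x) + c2 *\<^sub>R (X t (x + h2) - X t x) + c3 *\<^sub>R (X t (x + h3) - X t x))
    \<le> (C * growth t ^ 3) * (\<bar>c1\<bar> * (norm h1)\<^sup>2 + \<bar>c2\<bar> * (norm h2)\<^sup>2 + \<bar>c3\<bar> * (norm h3)\<^sup>2)"
proof -
  define q where "q s h = X s (x + h) - X s x" for s h
  define r where "r s h = b (X s (x + h)) - b (X s x)" for s h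
  define u where "u s = c1 *\<^sub>R q s h1 + c2 *\<^sub>R q s h2 + c3 *\<^sub>R q s h3" for s
  define S where "S = \<bar>c1\<bar> * (norm h1)\<^sup>2 + \<bar>c2\<bar> * (norm h2)\<^sup>2 + \<bar>c3\<bar> * (norm h3)\<^sup>2"
  have S: "S \<ge> 0" by (auto simp: S_def)
  have du: "(u has_vector_derivative c1 *\<^sub>R r s h1 + c2 *\<^sub>R r s h2 + c3 *\<^sub>R r s h3) (at s)" for s
    unfolding u_def q_def r_def
    by (intro has_vector_derivative_add has_vector_derivative_diff flow_deriv
        bounded_linear.has_vector_derivative[OF bounded_linear_scaleR_right])
  have quad: "norm (r s h - B (X s x) *v q s h) \<le> C * (growth t)\<^sup>2 * (norm h)\<^sup>2" if "\<bar>s\<bar> \<le> \<bar>t\<bar>" for s h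
  proof -
    have "norm (q s h) \<le> norm h * growth t"
      using flow_lipschitz[of s "x + h" x] growth_mono[OF that] unfolding q_def
      by (smt (verit) add_diff_cancel_left' mult_left_mono norm_ge_zero)
    then have "C * (norm (q s h))\<^sup>2 \<le> C * (norm h * growth t)\<^sup>2"
      using nonneg by (intro mult_left_mono power_mono) auto
    then show ?thesis
      using b_taylor[of "X s (x + h)" "X s x"] by (simp add: q_def r_def power_mult_distrib mult_ac)
  qed
  have bound: "norm (c1 *\<^sub>R r s h1 + c2 *\<^sub>R r s h2 + c3 *\<^sub>R r s h3) \<le> L * norm (u s) + C * (growth t)\<^sup>2 * S"
    if s: "\<bar>s\<bar> \<le> \<bar>t\<bar>" for s
  proof -
    let ?e = "\<lambda>h. r s h - B (X s x) *v q s h"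
    have "norm (c1 *\<^sub>R r s h1 + c2 *\<^sub>R r s h2 + c3 *\<^sub>R r s h3)
        = norm (B (X s x) *v u s + (c1 *\<^sub>R ?e h1 + c2 *\<^sub>R ?e h2 + c3 *\<^sub>R ?e h3))"
      by (simp add: u_def matrix_vector_right_distrib algebra_simps matrix_vector_mult_scaleR)
    also have "\<dots> \<le> L * norm (u s) + (\<bar>c1\<bar> * norm (?e h1) + \<bar>c2\<bar> * norm (?e h2) + \<bar>c3\<bar> * norm (?e h3))"
      by (intro norm_triangle_mono B_bound) simp_all
    also have "\<dots> \<le> L * norm (u s) + (\<bar>c1\<bar> * (C * (growth t)\<^sup>2 * (norm h1)\<^sup>2)
        + \<bar>c2\<bar> * (C * (growth t)\<^sup>2 * (norm h2)\<^sup>2) + \<bar>c3\<bar> * (C * (growth t)\<^sup>2 * (norm h3)\<^sup>2))"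
      by (intro add_mono mult_left_mono quad s order_refl) auto
    also have "\<dots> = L * norm (u s) + C * (growth t)\<^sup>2 * S" by (simp add: S_def algebra_simps)
    finally show ?thesis .
  qed
  have "u 0 = 0" using assms by (simp add: u_def q_def)
  moreover have "norm (u t) \<le> (norm (u 0) + C * (growth t)\<^sup>2 * S) * exp ((L + 1) * \<bar>t\<bar>)"
    by (rule gronwall[OF _ _ du bound]) (use nonneg S in auto)
  ultimately show ?thesis
    unfolding growth_def[symmetric]
    by (simp add: u_def q_def S_def power3_eq_cube power2_eq_square mult_ac)
qed

text \<open>
  The second claim, that the difference quotients converge, transports measurability and time estimates
  from the flow to its derivative.
\<close>

lemma flow_has_derivative:
  shows "(X t has_derivative (\<lambda>h. jacobian (X t) (at x) *v h)) (at x)"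
    and "(\<lambda>n. real (Suc n) *\<^sub>R (X t (x + inverse (real (Suc n)) *\<^sub>R h) - X t x)) \<longlonglongrightarrow> jacobian (X t) (at x) *v h"
proof -
  obtain A where A: "linear A" "\<And>h. norm ((X t (x + h) - X t x) - A h) \<le> (C * growth t ^ 3) * (norm h)\<^sup>2"
    "\<And>h. (\<lambda>n. real (Suc n) *\<^sub>R (X t (x + inverse (real (Suc n)) *\<^sub>R h) - X t x)) \<longlonglongrightarrow> A h"
    by (rule almost_linear_limit[where q = "\<lambda>h. X t (x + h) - X t x", OF flow_almost_linear]) (assumption, (rule that; assumption))
  have "norm (X t y - X t x - A (y - x)) \<le> (C * growth t ^ 3) * (norm (y - x))\<^sup>2" for y
    using A(2)[of "y - x"] by simp
  with A(1) have D: "(X t has_derivative A) (at x)"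
    by (intro has_derivative_quadratic_remainder[where e = 1]) (auto simp: linear_conv_bounded_linear)
  then show D': "(X t has_derivative (\<lambda>h. jacobian (X t) (at x) *v h)) (at x)"
    using jacobian_works differentiableI by blast
  have "A = (\<lambda>h. jacobian (X t) (at x) *v h)"
    by (rule has_derivative_unique[OF D D'])
  with A(3) show "(\<lambda>n. real (Suc n) *\<^sub>R (X t (x + inverse (real (Suc n)) *\<^sub>R h) - X t x)) \<longlonglongrightarrow> jacobian (X t) (at x) *v h"
    by simp
qed

lemma jacobian_flow_add:
  "jacobian (X (s + t)) (at x) = jacobian (X s) (at (X t x)) ** jacobian (X t) (at x)"
proof -
  have "(X (s + t) has_derivative (\<lambda>h. jacobian (X s) (at (X t x)) *v (jacobian (X t) (at x) *v h))) (at x)"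
    unfolding flow_add[abs_def] by (rule has_derivative_compose[OF flow_has_derivative(1) flow_has_derivative(1)])
  then have "(\<lambda>h. jacobian (X s) (at (X t x)) *v (jacobian (X t) (at x) *v h)) = (\<lambda>h. jacobian (X (s + t)) (at x) *v h)"
    using flow_has_derivative(1) has_derivative_unique by blast
  then have "jacobian (X (s + t)) (at x) *v h = (jacobian (X s) (at (X t x)) ** jacobian (X t) (at x)) *v h" for h
    unfolding matrix_vector_mul_assoc[symmetric] by (rule fun_cong[OF sym])
  then show ?thesis
    unfolding matrix_eq by blast
qed

lemma flow_jac_add: "flow_jac X (s + t) x = flow_jac X s (X t x) * flow_jac X t x"
  by (simp add: flow_jac_def jacobian_flow_add det_mul abs_mult)

lemma jacobian_flow_0: "jacobian (X 0) (at x) = mat 1"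
proof -
  have "X 0 = (\<lambda>x. x)" by (simp add: fun_eq_iff)
  then have "(X 0 has_derivative (\<lambda>h. h)) (at x)" by simp
  then have "(\<lambda>h. h) = (\<lambda>h. jacobian (X 0) (at x) *v h)"
    using flow_has_derivative(1) has_derivative_unique by blast
  then have "jacobian (X 0) (at x) *v h = mat 1 *v h" for h
    unfolding matrix_vector_mul_lid by (rule fun_cong[OF sym])
  then show ?thesis unfolding matrix_eq by blast
qed

lemma flow_jac_0 [simp]: "flow_jac X 0 x = 1"
  by (simp add: flow_jac_def jacobian_flow_0)

lemma flow_jac_pos: "0 < flow_jac X t x"
proof -
  have "flow_jac X (- t) (X t x) * flow_jac X t x = 1"
    using flow_jac_add[of "- t" t x] by simp
  moreover have "0 \<le> flow_jac X t x" by (simp add: flow_jac_def)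
  ultimately show ?thesis by (metis less_le mult_zero_right zero_neq_one)
qed

text \<open>
  The first-order expansion at time $0$ of the variational equation. It is first shown for the difference quotients \<open>w n\<close>,
  which satisfy a genuine differential equation, with an error that vanishes as \<open>n\<close> grows.
\<close>

lemma jacobian_flow_expansion:
  assumes "\<bar>t\<bar> \<le> 1"
  shows "norm (jacobian (X t) (at x) *v h - h - t *\<^sub>R (B x *v h)) \<le> (L * L * growth 1 + C * M) * norm h * t\<^sup>2"
proof -
  let ?g = "growth 1"
  define c where "c = (L * L * ?g + C * M) * norm h"
  define d where "d = C * ?g\<^sup>2 * (norm h)\<^sup>2"
  define k where "k n = inverse (real (Suc n)) *\<^sub>R h" for n
  define w where "w n s = real (Suc n) *\<^sub>R (X s (x + k n) - X s x)" for n s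
  define w' where "w' n s = real (Suc n) *\<^sub>R (b (X s (x + k n)) - b (X s x))" for n s
  have dw: "(w n has_vector_derivative w' n s) (at s)" for n s
    unfolding w_def w'_def
    by (intro has_vector_derivative_diff flow_deriv
        bounded_linear.has_vector_derivative[OF bounded_linear_scaleR_right])
  have w0: "w n 0 = h" for n
    by (simp add: w_def k_def del: of_nat_Suc)
  have Xk: "norm (X s (x + k n) - X s x) \<le> inverse (real (Suc n)) * norm h * ?g" if "\<bar>s\<bar> \<le> 1" for n s
  proof -
    have "norm (X s (x + k n) - X s x) \<le> norm (k n) * growth s"
      using flow_lipschitz[of s "x + k n" x] by simp
    also have "\<dots> \<le> norm (k n) * ?g"
      using growth_mono[of s 1] that by (intro mult_left_mono) auto
    finally show ?thesis by (simp add: k_def del: of_nat_Suc)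
  qed
  have w'_bound: "norm (w' n s) \<le> L * norm h * ?g" if "\<bar>s\<bar> \<le> 1" for n s
  proof -
    have "norm (w' n s) \<le> real (Suc n) * (L * (inverse (real (Suc n)) * norm h * ?g))"
      unfolding w'_def norm_scaleR
      using order_trans[OF b_lipschitz mult_left_mono[OF Xk[OF that] nonneg(2)]] by (intro mult_mono) auto
    also have "\<dots> = L * norm h * ?g" by simp
    finally show ?thesis .
  qed
  have "norm (w n t - h - t *\<^sub>R (B x *v h)) \<le> (c * \<bar>t\<bar> + d * inverse (real (Suc n))) * \<bar>t\<bar>" for n
  proof -
    let ?v = "\<lambda>s. w n s - h - s *\<^sub>R (B x *v h)"
    have "norm (?v t - ?v 0) \<le> (c * \<bar>t\<bar> + d * inverse (real (Suc n))) * \<bar>t\<bar>"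
    proof (rule vector_mean_value_bound)
      fix s assume s: "\<bar>s\<bar> \<le> \<bar>t\<bar>"
      then have s1: "\<bar>s\<bar> \<le> 1" using assms by simp
      show "(?v has_vector_derivative w' n s - B x *v h) (at s)"
        by (auto intro!: derivative_eq_intros dw)
      have "norm (w n s - w n 0) \<le> (L * norm h * ?g) * \<bar>s\<bar>"
        by (rule vector_mean_value_bound[OF dw]) (use s1 in \<open>auto intro!: w'_bound\<close>)
      also have "\<dots> \<le> (L * norm h * ?g) * \<bar>t\<bar>"
        using s nonneg growth_ge_1[of 1] by (intro mult_left_mono mult_nonneg_nonneg) auto
      finally have 1: "norm (B (X s x) *v (w n s - h)) \<le> L * ((L * norm h * ?g) * \<bar>t\<bar>)"
        unfolding w0 using nonneg by (intro order_trans[OF B_bound] mult_left_mono) auto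
      have "norm (X s x - x) \<le> M * \<bar>t\<bar>"
        using flow_speed[of s x 0] s nonneg(1) by (simp, meson mult_left_mono order_trans)
      then have 2: "norm ((B (X s x) - B x) *v h) \<le> C * (M * \<bar>t\<bar>) * norm h"
        using nonneg by (intro order_trans[OF B_lipschitz] mult_right_mono mult_left_mono) auto
      have "norm (w' n s - B (X s x) *v w n s)
          = real (Suc n) * norm (b (X s (x + k n)) - b (X s x) - B (X s x) *v (X s (x + k n) - X s x))"
        unfolding w_def w'_def matrix_vector_mult_scaleR scaleR_diff_right[symmetric] norm_scaleR by simp
      also have "\<dots> \<le> real (Suc n) * (C * (inverse (real (Suc n)) * norm h * ?g)\<^sup>2)"
        using nonneg by (intro mult_left_mono order_trans[OF b_taylor] power_mono Xk[OF s1]) auto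
      also have "\<dots> = d * inverse (real (Suc n))"
        by (simp add: d_def power2_eq_square field_simps del: of_nat_Suc)
      finally have 3: "norm (w' n s - B (X s x) *v w n s) \<le> d * inverse (real (Suc n))" .
      have "w' n s - B x *v h = (w' n s - B (X s x) *v w n s) + B (X s x) *v (w n s - h) + (B (X s x) - B x) *v h"
        by (simp add: matrix_vector_mult_diff_distrib matrix_vector_mult_diff_rdistrib)
      then have "norm (w' n s - B x *v h) \<le> d * inverse (real (Suc n)) + L * ((L * norm h * ?g) * \<bar>t\<bar>) + C * (M * \<bar>t\<bar>) * norm h"
        using norm_triangle_mono[OF norm_triangle_mono[OF 3 1] 2] by (simp only:)
      also have "\<dots> = c * \<bar>t\<bar> + d * inverse (real (Suc n))"
        by (simp add: c_def algebra_simps)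
      finally show "norm (w' n s - B x *v h) \<le> c * \<bar>t\<bar> + d * inverse (real (Suc n))" .
    qed
    then show ?thesis by (simp add: w0)
  qed
  moreover have "(\<lambda>n. norm (w n t - h - t *\<^sub>R (B x *v h))) \<longlonglongrightarrow> norm (jacobian (X t) (at x) *v h - h - t *\<^sub>R (B x *v h))"
    unfolding w_def k_def by (intro tendsto_intros flow_has_derivative(2))
  moreover have "(\<lambda>n. (c * \<bar>t\<bar> + d * inverse (real (Suc n))) * \<bar>t\<bar>) \<longlonglongrightarrow> (c * \<bar>t\<bar> + 0) * \<bar>t\<bar>"
    by (intro tendsto_intros LIMSEQ_const_times_inverse_Suc)
  ultimately have "norm (jacobian (X t) (at x) *v h - h - t *\<^sub>R (B x *v h)) \<le> (c * \<bar>t\<bar> + 0) * \<bar>t\<bar>"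
    by (intro LIMSEQ_le[of _ _ "\<lambda>n. (c * \<bar>t\<bar> + d * inverse (real (Suc n))) * \<bar>t\<bar>"]) blast+
  then show ?thesis by (simp add: c_def power2_eq_square mult_ac)
qed

text \<open>
  At time $0$ this is the derivative of the determinant at the identity; the chain rule for
  $X_{s+t} = X_s \circ X_t$ carries it to all times.
\<close>

theorem liouville:
  "((\<lambda>t. flow_jac X t x) has_real_derivative flow_jac X t x * trace (B (X t x))) (at t)"
proof -
  have entry: "((\<lambda>s. jacobian (X s) (at y) $ i $ j) has_real_derivative B y $ i $ j) (at 0)" for y i j
    unfolding has_field_derivative_def
  proof (rule has_derivative_quadratic_remainder[where e = 1])
    fix s :: real assume "norm (s - 0) < 1"
    then have s: "\<bar>s\<bar> \<le> 1" by simp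
    have col: "(N *v axis j 1) $ i = N $ i $ j" for N :: "real^'n^'n"
      by (simp add: matrix_vector_mult_basis column_def)
    let ?e = "jacobian (X s) (at y) *v axis j 1 - axis j 1 - s *\<^sub>R (B y *v axis j 1)"
    have "axis j 1 $ i = (mat 1 :: real^'n^'n) $ i $ j" by (simp add: axis_def mat_def)
    then have "norm (jacobian (X s) (at y) $ i $ j - jacobian (X 0) (at y) $ i $ j - B y $ i $ j * (s - 0)) = \<bar>?e $ i\<bar>"
      by (simp add: col jacobian_flow_0 mult.commute)
    also have "\<dots> \<le> norm ?e" by (rule component_le_norm_cart)
    also have "\<dots> \<le> (L * L * growth 1 + C * M) * (norm (s - 0))\<^sup>2"
      using jacobian_flow_expansion[OF s, of y "axis j 1"] by (simp add: norm_axis_1)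
    finally show "norm (jacobian (X s) (at y) $ i $ j - jacobian (X 0) (at y) $ i $ j - B y $ i $ j * (s - 0))
      \<le> (L * L * growth 1 + C * M) * (norm (s - 0))\<^sup>2" .
  qed (auto intro: bounded_linear_mult_right)
  \<comment> \<open>The determinant is positive near time $0$, where the absolute value can be dropped.\<close>
  have at0: "((\<lambda>s. flow_jac X s y) has_real_derivative trace (B y)) (at 0)" for y
  proof -
    have d: "((\<lambda>s. det (jacobian (X s) (at y))) has_real_derivative trace (B y)) (at 0)"
      by (rule det_has_derivative_at_identity[OF entry jacobian_flow_0])
    then have "isCont (\<lambda>s. det (jacobian (X s) (at y))) 0" by (rule DERIV_isCont)
    then have "\<forall>\<^sub>F s in at 0. 0 < det (jacobian (X s) (at y))"
      by (intro order_tendstoD(1)) (auto simp: isCont_def jacobian_flow_0)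
    then have "\<forall>\<^sub>F s in nhds 0. 0 < det (jacobian (X s) (at y))"
      by (simp add: eventually_nhds_conv_at jacobian_flow_0)
    then have "\<forall>\<^sub>F s in nhds 0. flow_jac X s y = det (jacobian (X s) (at y))"
      by eventually_elim (simp add: flow_jac_def)
    from DERIV_cong_ev[OF refl this refl] d show ?thesis by simp
  qed
  have "((\<lambda>s. flow_jac X (s + t) x) has_real_derivative trace (B (X t x)) * flow_jac X t x) (at 0)"
    unfolding flow_jac_add by (rule DERIV_cmult_right[OF at0])
  then show ?thesis
    using DERIV_shift[of "\<lambda>s. flow_jac X s x" "trace (B (X t x)) * flow_jac X t x" 0 t] by (simp add: mult.commute)
qed

lemma flow_measurable [measurable]: "(\<lambda>p. X (fst p) (snd p)) \<in> borel_measurable borel"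
  using borel_measurable_continuous_onI[OF flow_continuous] by (simp add: case_prod_beta')

text \<open>
  Joint measurability, needed for Tonelli: the entries of the Jacobian matrix are pointwise limits of
  difference quotients of the jointly continuous flow.
\<close>

lemma det_jacobian_flow_measurable:
  "(\<lambda>p. det (jacobian (X (fst p)) (at (snd p)))) \<in> borel_measurable borel"
proof -
  have "(\<lambda>p. jacobian (X (fst p)) (at (snd p)) $ i $ j) \<in> borel_measurable borel" for i j
  proof (rule borel_measurable_LIMSEQ_real)
    let ?w = "\<lambda>n p. real (Suc n) *\<^sub>R (X (fst p) (snd p + inverse (real (Suc n)) *\<^sub>R axis j 1) - X (fst p) (snd p))"
    fix p :: "real \<times> (real^'n)"
    show "(\<lambda>n. ?w n p $ i) \<longlonglongrightarrow> jacobian (X (fst p)) (at (snd p)) $ i $ j"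
      using tendsto_vec_nth[OF flow_has_derivative(2)[of "fst p" "snd p" "axis j 1"], of i]
      by (simp add: matrix_vector_mult_basis column_def)
    fix n
    have "continuous_on UNIV (\<lambda>p. ?w n p $ i)"
      by (intro continuous_intros continuous_on_flow)
    then show "(\<lambda>p. ?w n p $ i) \<in> borel_measurable borel"
      by (rule borel_measurable_continuous_onI)
  qed
  note [measurable] = this
  show ?thesis unfolding det_def by measurable
qed

lemma flow_jac_measurable: "(\<lambda>p. flow_jac X (fst p) (snd p)) \<in> borel_measurable borel"
  unfolding flow_jac_def using det_jacobian_flow_measurable by simp

end

section \<open>Transport of integrals over the torus\<close>

text \<open>
  The half-open cell contains exactly one point of each orbit of the lattice, unlike the closed cell, from which
  it differs by a null set.
\<close>

definition unit_cell :: "(real^'n) set" where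
  "unit_cell = {x. \<forall>i. 0 \<le> x $ i \<and> x $ i < 1}"

lemma unit_cell_borel [measurable]: "unit_cell \<in> sets borel"
  unfolding unit_cell_def by measurable

lemma nn_integral_lattice_unit_cell:
  fixes x :: "real^'n"
  shows "(\<integral>\<^sup>+ k. indicator unit_cell (x + int_vec k) \<partial>count_space UNIV) = 1"
    and "(\<integral>\<^sup>+ k. indicator unit_cell (x - int_vec k) \<partial>count_space UNIV) = 1"
proof -
  have one: "(\<integral>\<^sup>+ k. indicator {k0} k \<partial>count_space UNIV) = 1" for k0 :: "int^'n"
    by simp
  have "(0 \<le> r + of_int m \<and> r + of_int m < 1) \<longleftrightarrow> m = - \<lfloor>r\<rfloor>" for r :: real and m
    by linarith
  then have "indicator unit_cell (x + int_vec k) = (indicator {\<chi> i. - \<lfloor>x $ i\<rfloor>} k :: ennreal)" for k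
    by (simp add: indicator_def unit_cell_def vec_eq_iff)
  then show "(\<integral>\<^sup>+ k. indicator unit_cell (x + int_vec k) \<partial>count_space UNIV) = 1"
    using one by simp
  have "(0 \<le> r - of_int m \<and> r - of_int m < 1) \<longleftrightarrow> m = \<lfloor>r\<rfloor>" for r :: real and m
    by linarith
  then have "indicator unit_cell (x - int_vec k) = (indicator {\<chi> i. \<lfloor>x $ i\<rfloor>} k :: ennreal)" for k
    by (simp add: indicator_def unit_cell_def vec_eq_iff)
  then show "(\<integral>\<^sup>+ k. indicator unit_cell (x - int_vec k) \<partial>count_space UNIV) = 1"
    using one by simp
qed

text \<open>
  The indicators of the translates of the cell sum to $1$; interchanging sum and integral and translating
  back each term gives the formula.
\<close>

lemma nn_integral_tiling:
  fixes F :: "real^'n \<Rightarrow> ennreal"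
  assumes [measurable]: "F \<in> borel_measurable borel"
  shows "(\<integral>\<^sup>+ y. F y \<partial>lborel)
    = (\<integral>\<^sup>+ k. (\<integral>\<^sup>+ y. F (y + int_vec k) * indicator unit_cell y \<partial>lborel) \<partial>count_space UNIV)"
proof -
  have "(\<integral>\<^sup>+ y. F y \<partial>lborel)
      = (\<integral>\<^sup>+ y. (\<integral>\<^sup>+ k. F y * indicator unit_cell (y - int_vec k) \<partial>count_space UNIV) \<partial>lborel)"
    by (simp add: nn_integral_cmult nn_integral_lattice_unit_cell)
  also have "\<dots> = (\<integral>\<^sup>+ k. (\<integral>\<^sup>+ y. F y * indicator unit_cell (y - int_vec k) \<partial>lborel) \<partial>count_space UNIV)"
    by (rule nn_integral_count_space_nn_integral) (auto intro: countableI_type)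
  also have "\<dots> = (\<integral>\<^sup>+ k. (\<integral>\<^sup>+ y. F (y + int_vec k) * indicator unit_cell y \<partial>lborel) \<partial>count_space UNIV)"
  proof (rule nn_integral_cong)
    fix k :: "int^'n"
    have "(\<integral>\<^sup>+ y. F y * indicator unit_cell (y - int_vec k) \<partial>lborel)
        = (\<integral>\<^sup>+ y. F y * indicator unit_cell (y - int_vec k) \<partial>distr lborel borel ((+) (int_vec k)))"
      by (simp add: lborel_distr_plus)
    also have "\<dots> = (\<integral>\<^sup>+ y. F (y + int_vec k) * indicator unit_cell y \<partial>lborel)"
      by (subst nn_integral_distr) (simp_all add: add.commute)
    finally show "(\<integral>\<^sup>+ y. F y * indicator unit_cell (y - int_vec k) \<partial>lborel)
        = (\<integral>\<^sup>+ y. F (y + int_vec k) * indicator unit_cell y \<partial>lborel)" .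
  qed
  finally show ?thesis .
qed

context smooth_flow
begin

lemma flow_add_int_vec:
  assumes "periodic b"
  shows "X t (x + int_vec k) = X t x + int_vec k"
proof -
  have "((\<lambda>s. X s x + int_vec k) has_vector_derivative b (X s x + int_vec k)) (at s)" for s
    unfolding periodic_add_int_vec[OF assms]
    using has_vector_derivative_add[OF flow_deriv has_vector_derivative_const] by simp
  from trajectory_unique[OF this, of t] show ?thesis by simp
qed

lemma det_jacobian_flow_measurable_space: "(\<lambda>x. det (jacobian (X t) (at x))) \<in> borel_measurable borel"
  and flow_jac_measurable_space [measurable]: "(\<lambda>x. flow_jac X t x) \<in> borel_measurable borel"
  and flow_measurable_space [measurable]: "X t \<in> borel_measurable borel"
proof -
  show *: "(\<lambda>x. det (jacobian (X t) (at x))) \<in> borel_measurable borel"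
    using measurable_compose[of "\<lambda>x. (t, x)" borel "borel \<Otimes>\<^sub>M borel",
        OF _ det_jacobian_flow_measurable[folded borel_prod]] by simp
  show "(\<lambda>x. flow_jac X t x) \<in> borel_measurable borel"
    unfolding flow_jac_def using * by simp
  show "X t \<in> borel_measurable borel"
    by (intro borel_measurable_continuous_onI continuous_on_flow continuous_on_const continuous_on_id)
qed

text \<open>
  The flow maps the unit cell to another fundamental domain of the lattice. After the change of variables on
  the whole space, the integral over this domain is cut along the translates of the unit cell and reassembled, using
  that the integrand is periodic and that the translates of the image of the cell tile the space as well.
\<close>

lemma nn_integral_torus_change_of_variables:
  fixes \<phi> :: "real^'n \<Rightarrow> ennreal"
  assumes b: "periodic b" and \<phi>: "periodic \<phi>" and [measurable]: "\<phi> \<in> borel_measurable borel"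
  shows "(\<integral>\<^sup>+ x. \<phi> x * ennreal (flow_jac X t x) * indicator unit_cell x \<partial>lborel)
    = (\<integral>\<^sup>+ y. \<phi> (X (- t) y) * indicator unit_cell y \<partial>lborel)"
proof -
  let ?G = "\<lambda>y. \<phi> (X (- t) y) * indicator unit_cell (X (- t) y)"
  have jac: "\<bar>det (matrix (\<lambda>h. jacobian (X t) (at x) *v h))\<bar> = flow_jac X t x" for x
    by (simp add: flow_jac_def)
  have "(\<integral>\<^sup>+ x. \<phi> x * ennreal (flow_jac X t x) * indicator unit_cell x \<partial>lborel)
      = (\<integral>\<^sup>+ x. ?G (X t x) * ennreal (flow_jac X t x) \<partial>lborel)"
    by (simp add: mult_ac)
  also have "\<dots> = (\<integral>\<^sup>+ y. ?G y \<partial>lborel)"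
    using nn_integral_change_of_variables[OF flow_bij flow_has_derivative(1), of t ?G] det_jacobian_flow_measurable_space
    unfolding jac by simp
  also have "\<dots> = (\<integral>\<^sup>+ k. (\<integral>\<^sup>+ y. ?G (y + int_vec k) * indicator unit_cell y \<partial>lborel) \<partial>count_space UNIV)"
    by (rule nn_integral_tiling) measurable
  also have "\<dots> = (\<integral>\<^sup>+ k. (\<integral>\<^sup>+ y. \<phi> (X (- t) y) * indicator unit_cell y
      * indicator unit_cell (X (- t) y + int_vec k) \<partial>lborel) \<partial>count_space UNIV)"
    by (simp add: flow_add_int_vec[OF b] periodic_add_int_vec[OF \<phi>] mult_ac)
  also have "\<dots> = (\<integral>\<^sup>+ y. (\<integral>\<^sup>+ k. \<phi> (X (- t) y) * indicator unit_cell y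
      * indicator unit_cell (X (- t) y + int_vec k) \<partial>count_space UNIV) \<partial>lborel)"
    by (rule nn_integral_count_space_nn_integral[symmetric]) (auto intro: countableI_type)
  also have "\<dots> = (\<integral>\<^sup>+ y. \<phi> (X (- t) y) * indicator unit_cell y \<partial>lborel)"
    by (simp add: nn_integral_cmult nn_integral_lattice_unit_cell)
  finally show ?thesis .
qed

end

section \<open>Integrals over the real line\<close>

lemma nn_integral_real_le:
  fixes f :: "real \<Rightarrow> ennreal"
  assumes [measurable]: "f \<in> borel_measurable borel"
    and le: "\<And>n::nat. (\<integral>\<^sup>+ t. f t * indicator {- real n..real n} t \<partial>lborel) \<le> c"
  shows "(\<integral>\<^sup>+ t. f t \<partial>lborel) \<le> c"
proof -
  have "f t = (SUP n::nat. f t * indicator {- real n..real n} t)" for t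
  proof (rule antisym)
    obtain n :: nat where "\<bar>t\<bar> \<le> real n" using real_arch_simple by blast
    then have "f t = f t * indicator {- real n..real n} t" by (auto simp: indicator_def)
    then show "f t \<le> (SUP n::nat. f t * indicator {- real n..real n} t)"
      by (metis (no_types, lifting) SUP_upper UNIV_I)
  qed (auto intro!: SUP_least simp: indicator_def)
  then have "(\<integral>\<^sup>+ t. f t \<partial>lborel) = (\<integral>\<^sup>+ t. (SUP n::nat. f t * indicator {- real n..real n} t) \<partial>lborel)"
    by simp
  also have "\<dots> = (SUP n::nat. \<integral>\<^sup>+ t. f t * indicator {- real n..real n} t \<partial>lborel)"
    by (rule nn_integral_monotone_convergence_SUP)
       (auto simp: incseq_def le_fun_def indicator_def)
  also have "\<dots> \<le> c" by (rule SUP_least) (rule le)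
  finally show ?thesis .
qed

lemma tendsto_integral_symmetric_interval:
  fixes g :: "real \<Rightarrow> real"
  assumes "integrable lborel g"
  shows "((\<lambda>T. LINT t|lborel. g t * indicator {- T..T} t) \<longlongrightarrow> (LINT t|lborel. g t)) at_top"
proof (rule integral_dominated_convergence_at_top[where w = "\<lambda>t. norm (g t)"])
  show "AE t in lborel. ((\<lambda>T. g t * indicator {- T..T} t) \<longlongrightarrow> g t) at_top"
  proof (rule AE_I2)
    fix t
    have "\<forall>\<^sub>F T in at_top. g t * indicator {- T..T} t = g t"
      using eventually_ge_at_top[of "\<bar>t\<bar>"] by eventually_elim (auto simp: indicator_def)
    then show "((\<lambda>T. g t * indicator {- T..T} t) \<longlongrightarrow> g t) at_top"
      by (rule tendsto_eventually)
  qed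
qed (use assms in \<open>auto simp: indicator_def intro!: borel_measurable_times eventuallyI borel_measurable_integrable\<close>)

text \<open>
  With a nonzero limit, $|h|$ would exceed $|c|/2$ on arbitrarily long intervals.
\<close>

lemma integrable_limit_at_top_eq_0:
  fixes h :: "real \<Rightarrow> real"
  assumes int: "integrable lborel h" and lim: "(h \<longlongrightarrow> c) at_top"
  shows "c = 0"
proof (rule ccontr)
  assume "c \<noteq> 0"
  then have "\<forall>\<^sub>F t in at_top. \<bar>c\<bar> / 2 < \<bar>h t\<bar>"
    using order_tendstoD(1)[OF tendsto_rabs[OF lim], of "\<bar>c\<bar> / 2"] by simp
  then obtain N where N: "\<And>t. t \<ge> N \<Longrightarrow> \<bar>c\<bar> / 2 < \<bar>h t\<bar>"
    by (auto simp: eventually_at_top_linorder)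
  obtain k :: nat where k: "(LINT t|lborel. \<bar>h t\<bar>) < real k * (\<bar>c\<bar> / 2)"
    using reals_Archimedean3[of "\<bar>c\<bar> / 2"] \<open>c \<noteq> 0\<close> by auto
  have "(LINT t|lborel. (\<bar>c\<bar> / 2) * indicator {N..N + real k} t) \<le> (LINT t|lborel. \<bar>h t\<bar>)"
  proof (rule integral_mono)
    show "\<bar>c\<bar> / 2 * indicator {N..N + real k} t \<le> \<bar>h t\<bar>" for t
      using N[of t] by (auto simp: indicator_def)
  qed (use int in simp_all)
  moreover have "(LINT t|lborel. (\<bar>c\<bar> / 2) * indicator {N..N + real k} t) = real k * (\<bar>c\<bar> / 2)"
    by simp
  ultimately show False using k by linarith
qed

text \<open>
  The integral of \<open>g\<close> over $[-T,T]$ is $G(T) - G(-T)$. This converges as $T$ grows because \<open>g\<close> is integrable,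
  and the limit is $0$ because $T \mapsto G(T) - G(-T)$ is integrable too.
\<close>

lemma integral_derivative_eq_0:
  fixes G g :: "real \<Rightarrow> real"
  assumes "\<And>t. (G has_real_derivative g t) (at t)" "\<And>t. isCont g t"
    and G: "integrable lborel G" and g: "integrable lborel g"
  shows "(LINT t|lborel. g t) = 0"
proof (rule integrable_limit_at_top_eq_0[where h = "\<lambda>T. G T - G (- T)"])
  show "integrable lborel (\<lambda>T. G T - G (- T))"
    using G lborel_integrable_real_affine[OF G, of "-1" 0] by simp
  have "\<forall>\<^sub>F T in at_top. (LINT t|lborel. g t * indicator {- T..T} t) = G T - G (- T)"
    using eventually_ge_at_top[of 0]
  proof eventually_elim
    case (elim T)
    then show ?case using assms(1,2) by (intro integral_FTC_Icc_real) auto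
  qed
  then show "((\<lambda>T. G T - G (- T)) \<longlongrightarrow> (LINT t|lborel. g t)) at_top"
    using tendsto_integral_symmetric_interval[OF g] by (rule Lim_transform_eventually[rotated])
qed

section \<open>Gradient flows on the torus\<close>

lemma continuous_on_grad:
  assumes "smooth_torus V"
  shows "continuous_on UNIV (grad V)"
  by (intro continuous_at_imp_continuous_on ballI has_derivative_continuous[OF has_derivative_hessian(1)[OF assms]])

text \<open>
  Near a critical point the gradient is bounded below by a multiple of the distance, because
  the Hessian is injective. Critical points are therefore isolated, and there are at most countably many.
\<close>

lemma morse_critical_points_null:
  fixes V :: "real^'n \<Rightarrow> real"
  assumes "morse V"
  shows "{x. grad V x = 0} \<in> null_sets lborel"
proof -
  let ?S = "{x. grad V x = 0}"
  have V: "smooth_torus V" and inv: "\<And>x. grad V x = 0 \<Longrightarrow> invertible (hessian V x)"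
    using assms by (auto simp: morse_def)
  have "continuous_on UNIV (grad V)"
    by (rule continuous_on_grad[OF V])
  then have "closed ?S"
    using continuous_closed_preimage_constant[of UNIV "grad V" 0] by simp
  have "\<not> x islimpt ?S" for x
  proof
    assume lim: "x islimpt ?S"
    then have crit: "grad V x = 0" using \<open>closed ?S\<close> by (auto simp: closed_limpt)
    have "inj (\<lambda>h. hessian V x *v h)"
      using inv[OF crit] by (simp add: inj_matrix_vector_mult)
    then obtain c where c: "c > 0" "\<And>h. c * norm h \<le> norm (hessian V x *v h)"
      using linear_inj_bounded_below_pos[of "\<lambda>h. hessian V x *v h"] by auto
    obtain d where d: "d > 0" "\<And>y. norm (y - x) < d \<Longrightarrow>
        norm (grad V y - grad V x - hessian V x *v (y - x)) \<le> c / 2 * norm (y - x)"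
      using has_derivative_hessian(1)[OF V, of x] c(1) unfolding has_derivative_at_alt
      by (metis half_gt_zero_iff)
    obtain y where y: "y \<in> ?S" "y \<noteq> x" "dist y x < d"
      using lim d(1) unfolding islimpt_approachable by blast
    have "norm (hessian V x *v (y - x)) \<le> c / 2 * norm (y - x)"
      using d(2)[of y] y crit by (simp add: dist_norm)
    with c(2)[of "y - x"] have "c * norm (y - x) \<le> c / 2 * norm (y - x)" by linarith
    with c(1) y(2) show False by simp
  qed
  then have "?S sparse_in UNIV" by (auto simp: sparse_in_def)
  then have "countable ?S" using sparse_imp_countable[of UNIV ?S] by simp
  then show ?thesis by (rule countable_imp_null_set_lborel)
qed

lemma periodic_grad:
  assumes "smooth_torus V"
  shows "periodic (grad V)"
proof -
  have "periodic (partial i V)" for i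
    using smooth_torus_partial[OF assms] by (simp add: smooth_torus_def)
  then show ?thesis by (simp add: periodic_def grad_def vec_eq_iff)
qed

text \<open>
  Along the reversed flow $-V$ is a primitive of the integrand.
\<close>

lemma gradient_flow_energy:
  fixes V :: "real^'n \<Rightarrow> real"
  assumes V: "smooth_torus V" and flow: "is_flow (grad V) X" and M: "\<And>x. \<bar>V x\<bar> \<le> M"
  shows "(\<integral>\<^sup>+ t. ennreal ((norm (grad V (X (- t) y)))\<^sup>2) \<partial>lborel) \<le> ennreal (2 * M)"
proof (rule nn_integral_real_le)
  have dX: "((\<lambda>s. X s y) has_derivative (\<lambda>h. h *\<^sub>R grad V (X t y))) (at t)" for t
    using flow by (auto simp: is_flow_def has_vector_derivative_def)
  have X: "continuous_on UNIV (\<lambda>t. X t y)"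
    by (intro continuous_at_imp_continuous_on ballI has_derivative_continuous[OF dX])
  have "continuous_on UNIV (\<lambda>t. X (- t) y)"
    by (rule continuous_on_compose2[OF X]) (auto intro: continuous_intros)
  then have cont: "continuous_on UNIV (\<lambda>t. grad V (X (- t) y))"
    by (rule continuous_on_compose2[OF continuous_on_grad[OF V]]) simp
  have meas: "(\<lambda>t. (norm (grad V (X (- t) y)))\<^sup>2) \<in> borel_measurable borel"
    by (intro borel_measurable_continuous_onI continuous_intros cont)
  then show "(\<lambda>t. ennreal ((norm (grad V (X (- t) y)))\<^sup>2)) \<in> borel_measurable borel"
    by simp
  have dV: "((\<lambda>t. - V (X (- t) y)) has_real_derivative (norm (grad V (X (- t) y)))\<^sup>2) (at t)" for t
  proof -
    have "((\<lambda>s. V (X s y)) has_derivative (\<lambda>h. grad V (X t y) \<bullet> (h *\<^sub>R grad V (X t y)))) (at t)" for t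
      by (rule has_derivative_compose[OF dX has_derivative_grad[OF smooth_torusD(3)[OF V]]])
    then have "((\<lambda>s. V (X s y)) has_real_derivative (norm (grad V (X t y)))\<^sup>2) (at t)" for t
      by (simp add: has_field_derivative_def dot_square_norm mult_commute_abs)
    from DERIV_minus[OF DERIV_chain2[OF this DERIV_minus[OF DERIV_ident]]]
    show ?thesis by simp
  qed
  fix n :: nat
  have "(\<integral>\<^sup>+ t. ennreal ((norm (grad V (X (- t) y)))\<^sup>2) * indicator {- real n..real n} t \<partial>lborel)
      = ennreal (- V (X (- real n) y) - - V (X (- (- real n)) y))"
    by (intro nn_integral_FTC_Icc meas dV) auto
  also have "\<dots> \<le> ennreal (2 * M)"
    using M[of "X (- real n) y"] M[of "X (real n) y"] by (intro ennreal_leI) auto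
  finally show "(\<integral>\<^sup>+ t. ennreal ((norm (grad V (X (- t) y)))\<^sup>2) * indicator {- real n..real n} t \<partial>lborel) \<le> ennreal (2 * M)" .
qed

lemma unit_cell_emeasure_finite: "emeasure lborel (unit_cell :: (real^'n) set) < \<infinity>"
proof -
  have "emeasure lborel (unit_cell :: (real^'n) set) \<le> emeasure lborel (cbox 0 (1 :: real^'n))"
    by (intro emeasure_mono) (auto simp: unit_cell_def mem_box_cart less_imp_le)
  then show ?thesis using emeasure_lborel_cbox_finite[of 0 "1 :: real^'n"] by (simp add: order_le_less_trans)
qed

lemma AE_unit_cell: "AE x in lborel. x \<in> cbox 0 (1 :: real^'n) \<longrightarrow> x \<in> unit_cell"
proof -
  have "negligible (cbox 0 (1 :: real^'n) - box 0 1)"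
    using negligible_convex_frontier[OF convex_box(1), of 0 "1 :: real^'n"] by (simp add: frontier_cbox)
  then have "cbox 0 (1 :: real^'n) - box 0 1 \<in> null_sets lborel"
    by (simp add: negligible_iff_null_sets null_sets_completion_iff)
  then show ?thesis
    by (rule AE_I') (auto simp: unit_cell_def mem_box_cart less_imp_le)
qed

lemma gradient_smooth_flow:
  assumes V: "smooth_torus V" and flow: "is_flow (grad V) X"
  obtains M L C where "smooth_flow (grad V) (hessian V) M L C X"
proof -
  obtain M L C where bounds: "0 \<le> M" "0 \<le> L" "0 \<le> C" "\<And>x. norm (grad V x) \<le> M"
    "\<And>x h. norm (hessian V x *v h) \<le> L * norm h"
    "\<And>x y h. norm ((hessian V x - hessian V y) *v h) \<le> C * norm (x - y) * norm h"
    using grad_bounds[OF V] by blast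
  then have "smooth_flow (grad V) (hessian V) M L C X"
    using flow has_derivative_hessian(1)[OF V] by unfold_locales auto
  then show ?thesis by (rule that)
qed

context smooth_flow
begin

lemma continuous_on_flow_jac_time: "continuous_on UNIV (\<lambda>t. flow_jac X t x)"
  by (intro continuous_at_imp_continuous_on ballI DERIV_isCont[OF liouville])

lemma continuous_on_weighted_time:
  fixes h :: "real^'n \<Rightarrow> real"
  assumes "continuous_on UNIV h"
  shows "continuous_on UNIV (\<lambda>t. h (X t x) * flow_jac X t x)"
proof -
  have "continuous_on UNIV (\<lambda>t. X t x)"
    by (intro continuous_on_flow continuous_on_id continuous_on_const)
  then show ?thesis
    by (intro continuous_on_mult continuous_on_flow_jac_time continuous_on_compose2[OF assms]) auto
qed

lemma integrable_weighted_time: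
  fixes h :: "real^'n \<Rightarrow> real"
  assumes h: "continuous_on UNIV h" "\<And>x. \<bar>h x\<bar> \<le> c"
    and J: "integrable lborel (\<lambda>t. flow_jac X t x)"
  shows "integrable lborel (\<lambda>t. h (X t x) * flow_jac X t x)"
proof (rule Bochner_Integration.integrable_bound)
  show "integrable lborel (\<lambda>t. c * flow_jac X t x)" using J by simp
  have "\<bar>h (X t x)\<bar> * flow_jac X t x \<le> \<bar>c\<bar> * flow_jac X t x" for t
    using h(2)[of "X t x"] flow_jac_pos[of t x] by (intro mult_right_mono) auto
  then show "AE t in lborel. norm (h (X t x) * flow_jac X t x) \<le> norm (c * flow_jac X t x)"
    using flow_jac_pos by (simp add: abs_mult abs_of_pos)
  show "(\<lambda>t. h (X t x) * flow_jac X t x) \<in> borel_measurable lborel"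
    using borel_measurable_continuous_onI[OF continuous_on_weighted_time[OF h(1)]] by simp
qed

end

text \<open>
  The function \<open>H\<close> below weights the time integral of the Jacobian with $|\nabla V|^2$. Transporting
  the weight along the flow turns its integral over the cell into the energy of the orbits, which is bounded; so \<open>H\<close> is finite almost everywhere.
\<close>

lemma gradient_flow_jac_integrable:
  fixes V :: "real^'n \<Rightarrow> real"
  assumes V: "smooth_torus V" and flow: "is_flow (grad V) X"
  shows "AE x in lborel. x \<in> unit_cell \<longrightarrow> grad V x \<noteq> 0 \<longrightarrow> integrable lborel (\<lambda>t. flow_jac X t x)"
proof -
  obtain M L C where "smooth_flow (grad V) (hessian V) M L C X"
    using gradient_smooth_flow[OF V flow] .
  then interpret smooth_flow "grad V" "hessian V" M L C X .
  obtain K where K: "\<And>x. \<bar>V x\<bar> \<le> K"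
    using periodic_bounded smooth_torusD[OF V] by blast
  define \<phi> where "\<phi> x = ennreal ((norm (grad V x))\<^sup>2)" for x
  have "continuous_on UNIV (grad V)"
    by (rule continuous_on_grad[OF V])
  then have [measurable]: "\<phi> \<in> borel_measurable borel"
    unfolding \<phi>_def by (intro measurable_compose[OF borel_measurable_continuous_onI measurable_ennreal] continuous_intros)
  have per: "periodic \<phi>" using periodic_grad[OF V] by (simp add: periodic_def \<phi>_def)
  note [measurable] = flow_jac_measurable[folded borel_prod] flow_measurable[folded borel_prod]
  have [measurable]: "(\<lambda>p. X (- snd p) (fst p)) \<in> borel_measurable (borel \<Otimes>\<^sub>M borel)"
    using measurable_compose[of "\<lambda>p. (- snd p, fst p)" "borel \<Otimes>\<^sub>M borel" "borel \<Otimes>\<^sub>M borel",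
        OF _ flow_measurable[folded borel_prod]] by simp
  have [measurable]: "(\<lambda>p. flow_jac X (snd p) (fst p)) \<in> borel_measurable (borel \<Otimes>\<^sub>M borel)"
    using measurable_compose[of "\<lambda>p. (snd p, fst p)" "borel \<Otimes>\<^sub>M borel" "borel \<Otimes>\<^sub>M borel",
        OF _ flow_jac_measurable[folded borel_prod]] by simp
  have [measurable]: "(\<lambda>p. indicator unit_cell (fst p) :: ennreal) \<in> borel_measurable (lborel \<Otimes>\<^sub>M lborel)"
    by (rule measurable_compose[OF measurable_fst]) simp
  define H where "H x = (\<integral>\<^sup>+ t. \<phi> x * ennreal (flow_jac X t x) * indicator unit_cell x \<partial>lborel)" for x
  have "(\<integral>\<^sup>+ x. H x \<partial>lborel)
      = (\<integral>\<^sup>+ t. (\<integral>\<^sup>+ x. \<phi> x * ennreal (flow_jac X t x) * indicator unit_cell x \<partial>lborel) \<partial>lborel)"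
    unfolding H_def by (rule lborel_pair.Fubini') measurable
  also have "\<dots> = (\<integral>\<^sup>+ t. (\<integral>\<^sup>+ y. \<phi> (X (- t) y) * indicator unit_cell y \<partial>lborel) \<partial>lborel)"
    by (simp add: nn_integral_torus_change_of_variables[OF periodic_grad[OF V] per])
  also have "\<dots> = (\<integral>\<^sup>+ y. (\<integral>\<^sup>+ t. \<phi> (X (- t) y) * indicator unit_cell y \<partial>lborel) \<partial>lborel)"
    by (rule lborel_pair.Fubini') measurable
  also have "\<dots> = (\<integral>\<^sup>+ y. (\<integral>\<^sup>+ t. \<phi> (X (- t) y) \<partial>lborel) * indicator unit_cell y \<partial>lborel)"
    by (rule nn_integral_cong) (simp add: indicator_def)
  also have "\<dots> \<le> (\<integral>\<^sup>+ y. ennreal (2 * K) * indicator unit_cell (y :: real^'n) \<partial>lborel)"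
    by (rule nn_integral_mono, rule mult_right_mono)
       (simp_all add: \<phi>_def gradient_flow_energy[OF V assms(2) K])
  also have "\<dots> = ennreal (2 * K) * emeasure lborel (unit_cell :: (real^'n) set)"
    by (rule nn_integral_cmult_indicator) simp
  also have "\<dots> < \<infinity>"
    using unit_cell_emeasure_finite[where 'n = 'n] by (simp add: ennreal_mult_less_top)
  finally have "(\<integral>\<^sup>+ x. H x \<partial>lborel) \<noteq> \<infinity>" by simp
  moreover have "H \<in> borel_measurable lborel"
    unfolding H_def by measurable
  ultimately have "AE x in lborel. H x \<noteq> \<infinity>" by (intro nn_integral_PInf_AE)
  then show ?thesis
  proof eventually_elim
    case (elim x)
    show ?case
    proof (intro impI)
      assume "x \<in> unit_cell" "grad V x \<noteq> 0"
      have [measurable]: "(\<lambda>t. flow_jac X t x) \<in> borel_measurable borel"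
        by (rule borel_measurable_continuous_onI[OF continuous_on_flow_jac_time])
      have "H x = \<phi> x * (\<integral>\<^sup>+ t. ennreal (flow_jac X t x) \<partial>lborel)"
        using \<open>x \<in> unit_cell\<close> by (simp add: H_def nn_integral_cmult)
      moreover have "\<phi> x \<noteq> 0" using \<open>grad V x \<noteq> 0\<close> by (simp add: \<phi>_def)
      ultimately have "(\<integral>\<^sup>+ t. ennreal (flow_jac X t x) \<partial>lborel) \<noteq> \<infinity>"
        using elim by (auto simp: ennreal_mult_eq_top_iff)
      then show "integrable lborel (\<lambda>t. flow_jac X t x)"
        by (intro integrableI_nonneg) (auto simp: flow_jac_pos less_imp_le top.not_eq_extremum)
    qed
  qed
qed

lemma divergence_scaled_gradient:
  fixes D V :: "real^'n \<Rightarrow> real"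
  assumes D: "smooth_torus D" and V: "smooth_torus V"
  shows "divergence (\<lambda>y. D y *\<^sub>R grad V y) x = D x * trace (hessian V x) + grad D x \<bullet> grad V x"
proof -
  let ?f' = "\<lambda>h. D x *\<^sub>R (hessian V x *v h) + (grad D x \<bullet> h) *\<^sub>R grad V x"
  have "((\<lambda>y. D y *\<^sub>R grad V y) has_derivative ?f') (at x)"
    by (rule has_derivative_scaleR[OF has_derivative_grad[OF smooth_torusD(3)[OF D]] has_derivative_hessian(1)[OF V]])
  then have "jacobian (\<lambda>y. D y *\<^sub>R grad V y) (at x) = matrix ?f'"
    by (simp add: jacobian_def frechet_derivative_at[symmetric])
  then show ?thesis
    by (simp add: divergence_def trace_def matrix_def matrix_vector_mult_basis column_def
        inner_axis sum.distrib sum_distrib_left) (simp add: inner_vec_def)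
qed


text \<open>
  The integrand is the time derivative of $J_t(x) \, D(X_t(x))$.
\<close>

lemma gradient_flow_balance:
  fixes D V f :: "real^'n \<Rightarrow> real"
  assumes D: "smooth_torus D" and V: "smooth_torus V" and flow: "is_flow (grad V) X"
    and f: "\<And>x. divergence (\<lambda>y. D y *\<^sub>R grad V y) x = f x"
    and f_cont: "continuous_on UNIV f" and f_bound: "\<And>x. \<bar>f x\<bar> \<le> K"
    and J: "integrable lborel (\<lambda>t. flow_jac X t x)"
  shows "(LINT t|lborel. f (X t x) * flow_jac X t x) = 0"
proof (rule integral_derivative_eq_0[where G = "\<lambda>t. flow_jac X t x * D (X t x)"])
  obtain M L C where "smooth_flow (grad V) (hessian V) M L C X"
    using gradient_smooth_flow[OF V flow] .
  then interpret smooth_flow "grad V" "hessian V" M L C X .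
  show "((\<lambda>t. flow_jac X t x * D (X t x)) has_real_derivative f (X t x) * flow_jac X t x) (at t)" for t
  proof -
    have "((\<lambda>t. D (X t x)) has_real_derivative grad D (X t x) \<bullet> grad V (X t x)) (at t)"
      using has_derivative_compose[OF flow_deriv[unfolded has_vector_derivative_def]
          has_derivative_grad[OF smooth_torusD(3)[OF D]]]
      by (simp add: has_field_derivative_def mult_commute_abs)
    from DERIV_mult[OF liouville this] show ?thesis
      by (rule DERIV_cong) (simp add: f[symmetric] divergence_scaled_gradient[OF D V] algebra_simps)
  qed
  show "isCont (\<lambda>t. f (X t x) * flow_jac X t x) t" for t
    using continuous_on_weighted_time[OF f_cont] by (simp add: continuous_on_eq_continuous_at)
  obtain c where "\<And>x. \<bar>D x\<bar> \<le> c"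
    using periodic_bounded smooth_torusD[OF D] by blast
  from integrable_weighted_time[OF smooth_torusD(2)[OF D] this J]
  show "integrable lborel (\<lambda>t. flow_jac X t x * D (X t x))" by (simp add: mult.commute)
  show "integrable lborel (\<lambda>t. f (X t x) * flow_jac X t x)"
    by (rule integrable_weighted_time[OF f_cont f_bound J])
qed


section \<open>The zero-variance property\<close>

lemma exp_minus_smooth_torus:
  fixes U :: "real^'n \<Rightarrow> real"
  assumes U: "smooth_torus U"
  shows "continuous_on UNIV (\<lambda>x. exp (- U x))"
    and "\<exists>c. \<forall>x. \<bar>exp (- U x)\<bar> \<le> c"
    and "0 < (LINT x:torus_cell|lborel. exp (- U x))"
proof -
  show cont: "continuous_on UNIV (\<lambda>x. exp (- U x))"
    by (intro continuous_intros smooth_torusD(2)[OF U])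
  obtain M where M: "\<And>x. \<bar>U x\<bar> \<le> M"
    using periodic_bounded smooth_torusD[OF U] by blast
  have "exp (- U x) \<le> exp M" "exp (- M) \<le> exp (- U x)" for x
    using M[of x] by (simp_all add: abs_le_iff)
  note bound = this
  then show "\<exists>c. \<forall>x. \<bar>exp (- U x)\<bar> \<le> c" by auto
  have "cbox 0 (1 :: real^'n) \<noteq> {}"
    by (auto simp: interval_ne_empty_cart)
  then have "measure lborel (torus_cell :: (real^'n) set) = 1"
    by (simp add: content_cbox_cart)
  then have "exp (- M) = (LINT x:(torus_cell :: (real^'n) set)|lborel. exp (- M))"
    by (simp add: set_lebesgue_integral_def)
  also have "\<dots> \<le> (LINT x:torus_cell|lborel. exp (- U x))"
  proof (rule set_integral_mono)
    show "set_integrable lborel torus_cell (\<lambda>x :: real^'n. exp (- M))"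
      "set_integrable lborel torus_cell (\<lambda>x. exp (- U x))"
      unfolding set_integrable_def
      by (intro borel_integrable_compact compact_cbox continuous_on_const continuous_on_subset[OF cont]; simp)+
  qed (rule bound)
  finally show "0 < (LINT x:torus_cell|lborel. exp (- U x))"
    by (rule less_le_trans[OF exp_gt_zero])
qed

lemma AE_torus_measureI:
  assumes "continuous_on UNIV \<rho>" and "AE x in lborel. x \<in> torus_cell \<longrightarrow> P x"
  shows "AE x in torus_measure \<rho>. P x"
proof -
  have "\<rho> \<in> borel_measurable borel"
    using assms(1) by (rule borel_measurable_continuous_onI)
  then have "(\<lambda>x. ennreal (\<rho> x)) \<in> borel_measurable (restrict_space lborel torus_cell)"
    by (intro measurable_restrict_space1) simp
  then show ?thesis
    using assms(2) unfolding torus_measure_def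
    by (simp add: AE_density AE_restrict_space_iff) (auto elim: eventually_mono)
qed

theorem proposition3p1:
  fixes U0 U1 D V :: "real^'n \<Rightarrow> real"
    and \<rho>0 \<rho>1 :: "real^'n \<Rightarrow> real"
    and Z1 :: real
    and X :: "real \<Rightarrow> real^'n \<Rightarrow> real^'n"
  assumes U0: "smooth_torus U0" and U1: "smooth_torus U1"
    and normalized: "(LINT x:torus_cell|lborel. exp (- U0 x)) = 1"
    and \<rho>0_def: "\<rho>0 = (\<lambda>x. exp (- U0 x))"
    and Z1_def: "Z1 = (LINT x:torus_cell|lborel. exp (- U1 x))"
    and \<rho>1_def: "\<rho>1 = (\<lambda>x. exp (- U1 x) / Z1)"
    and D: "smooth_torus D" "\<And>x. D x > 0" "(INF x\<in>torus_cell. D x) > 0"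
    and V: "smooth_torus V"
    and poisson: "\<And>x. divergence (\<lambda>y. D y *\<^sub>R grad V y) x = \<rho>1 x - \<rho>0 x"
    and mean_zero: "(LINT x:torus_cell|lborel. V x) = 0"
    and morse: "morse V"
    and flow: "is_flow (grad V) X"
  shows "(AE x in torus_measure \<rho>0.
            integrable lborel (\<lambda>s. \<rho>0 (X s x) * flow_jac X s x) \<and>
            integrable lborel (\<lambda>s. \<rho>1 (X s x) * flow_jac X s x) \<and>
            (LINT s|lborel. \<rho>0 (X s x) * flow_jac X s x)
              = (LINT s|lborel. \<rho>1 (X s x) * flow_jac X s x)) \<and>
         (AE x in torus_measure \<rho>0. estimator U0 U1 X x = Z1)"
proof -
  obtain M L C where "smooth_flow (grad V) (hessian V) M L C X"
    using gradient_smooth_flow[OF V flow] .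
  then interpret smooth_flow "grad V" "hessian V" M L C X .
  note e0 = exp_minus_smooth_torus[OF U0] and e1 = exp_minus_smooth_torus[OF U1]
  have Z1: "Z1 > 0" using e1(3) by (simp add: Z1_def)
  obtain c0 c1 where c0: "\<And>x. \<bar>exp (- U0 x)\<bar> \<le> c0" and c1: "\<And>x. \<bar>exp (- U1 x)\<bar> \<le> c1"
    using e0(2) e1(2) by blast
  have cont0: "continuous_on UNIV \<rho>0" and cont1: "continuous_on UNIV \<rho>1"
    unfolding \<rho>0_def \<rho>1_def using Z1 by (auto intro!: continuous_intros e0(1) e1(1))
  have bound0: "\<bar>\<rho>0 x\<bar> \<le> c0" for x
    using c0 by (simp add: \<rho>0_def)
  have bound1: "\<bar>\<rho>1 x\<bar> \<le> c1 / Z1" for x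
    using divide_right_mono[OF c1[of x], of Z1] Z1 by (simp add: \<rho>1_def)
  have good: "AE x in lborel. x \<in> torus_cell \<longrightarrow> integrable lborel (\<lambda>t. flow_jac X t x)"
    using gradient_flow_jac_integrable[OF V flow] AE_unit_cell AE_not_in[OF morse_critical_points_null[OF morse]]
    by eventually_elim auto
  have main: "integrable lborel (\<lambda>s. \<rho>0 (X s x) * flow_jac X s x) \<and>
      integrable lborel (\<lambda>s. \<rho>1 (X s x) * flow_jac X s x) \<and>
      (LINT s|lborel. \<rho>0 (X s x) * flow_jac X s x) = (LINT s|lborel. \<rho>1 (X s x) * flow_jac X s x)"
    and est: "estimator U0 U1 X x = Z1"
    if J: "integrable lborel (\<lambda>t. flow_jac X t x)" for x
  proof -
    have i0: "integrable lborel (\<lambda>s. \<rho>0 (X s x) * flow_jac X s x)"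
      by (rule integrable_weighted_time[OF cont0 bound0 J])
    have i1: "integrable lborel (\<lambda>s. \<rho>1 (X s x) * flow_jac X s x)"
      by (rule integrable_weighted_time[OF cont1 bound1 J])
    have "\<bar>\<rho>1 x - \<rho>0 x\<bar> \<le> c1 / Z1 + c0" for x
      using bound0[of x] bound1[of x] by linarith
    from gradient_flow_balance[OF D(1) V flow poisson continuous_on_diff[OF cont1 cont0] this J]
    have eq: "(LINT s|lborel. \<rho>0 (X s x) * flow_jac X s x) = (LINT s|lborel. \<rho>1 (X s x) * flow_jac X s x)"
      using Bochner_Integration.integral_diff[OF i1 i0] by (simp add: left_diff_distrib)
    show "integrable lborel (\<lambda>s. \<rho>0 (X s x) * flow_jac X s x) \<and>
      integrable lborel (\<lambda>s. \<rho>1 (X s x) * flow_jac X s x) \<and>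
      (LINT s|lborel. \<rho>0 (X s x) * flow_jac X s x) = (LINT s|lborel. \<rho>1 (X s x) * flow_jac X s x)"
      using i0 i1 eq by blast
    have w0: "weight U0 X s x = \<rho>0 (X s x) * flow_jac X s x" for s
      by (simp add: weight_def \<rho>0_def)
    have w1: "weight U1 X s x = Z1 * (\<rho>1 (X s x) * flow_jac X s x)" for s
      using Z1 by (simp add: weight_def \<rho>1_def)
    have pos: "0 < \<rho>0 (X s x) * flow_jac X s x" for s
      by (simp add: \<rho>0_def flow_jac_pos)
    have "(LINT s|lborel. \<rho>0 (X s x) * flow_jac X s x) \<noteq> 0"
    proof
      assume "(LINT s|lborel. \<rho>0 (X s x) * flow_jac X s x) = 0"
      then have "AE s in lborel. \<rho>0 (X s x) * flow_jac X s x = 0"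
        using integral_nonneg_eq_0_iff_AE[OF i0] pos by (simp add: less_imp_le)
      then have "AE s in (lborel :: real measure). False"
        by eventually_elim (use pos in \<open>simp add: less_le\<close>)
      then show False by (simp add: AE_iff_measurable[OF _ refl])
    qed
    then show "estimator U0 U1 X x = Z1"
      using eq by (simp add: estimator_def w0 w1)
  qed
  show ?thesis
  proof
    show "AE x in torus_measure \<rho>0.
            integrable lborel (\<lambda>s. \<rho>0 (X s x) * flow_jac X s x) \<and>
            integrable lborel (\<lambda>s. \<rho>1 (X s x) * flow_jac X s x) \<and>
            (LINT s|lborel. \<rho>0 (X s x) * flow_jac X s x)
              = (LINT s|lborel. \<rho>1 (X s x) * flow_jac X s x)"
      by (rule AE_torus_measureI[OF cont0], use good in eventually_elim) (use main in blast)
    show "AE x in torus_measure \<rho>0. estimator U0 U1 X x = Z1"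
      by (rule AE_torus_measureI[OF cont0], use good in eventually_elim) (use est in blast)
  qed
qed

end
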